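(* There exist universal constants $C,c>0$ such that the following holds. Let $N\ge 2$, let $d_1,\dots,d_N$ be positive integers and $\mathbf r=(r_1,\dots,r_{N-1})$ positive integers, and set $\overline d=\max_i d_i$, $\overline r=\max_i r_i$. Let $\mathcal A:\mathbb R^{d_1\times\cdots\times d_N}\to\mathbb R^m$, $\mathcal A(\mathcal X)=(\langle \mathcal A_1,\mathcal X\rangle,\dots,\langle \mathcal A_m,\mathcal X\rangle)$, be a Gaussian measurement operator, i.e. the tensors $\mathcal A_1,\dots,\mathcal A_m$ have i.i.d. standard Gaussian entries. Let $\delta_{\overline r}\in(0,\sqrt{2/\pi})$. If $$m\ \ge\ C\,\frac{N\overline d\,\overline r^2\log N}{\delta_{\overline r}^2},$$ then with probability exceeding $1-e^{-cN\overline d\,\overline r^2\log N}$, the inequalities $$\left(\sqrt{2/\pi}-\delta_{\overline r}\right)\|\mathcal X\|_F\ \le\ \frac1m\|\mathcal A(\mathcal X)\|_1\ \le\ \left(\sqrt{2/\pi}+\delta_{\overline r}\right)\|\mathcal X\|_F$$ hold simultaneously for all tensors $\mathcal X\in\mathbb R^{d_1\times\cdots\times d_N}$ in tensor train format with ranks $\mathbf r$.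
   Context: A tensor $\mathcal X\in\mathbb R^{d_1\times\cdots\times d_N}$ is in tensor train (TT) format with ranks $\mathbf r=(r_1,\dots,r_{N-1})$ if there are order-3 tensors (factors) $\mathbf X_i\in\mathbb R^{r_{i-1}\times d_i\times r_i}$, $i=1,\dots,N$, with $r_0=r_N=1$, such that $\mathcal X(s_1,\dots,s_N)=\mathbf X_1(s_1)\mathbf X_2(s_2)\cdots\mathbf X_N(s_N)$ for all indices, where $\mathbf X_i(s_i)=\mathbf X_i(:,s_i,:)\in\mathbb R^{r_{i-1}\times r_i}$. $\langle\cdot,\cdot\rangle$ is the entrywise inner product of tensors, $\|\mathcal X\|_F=\sqrt{\langle\mathcal X,\mathcal X\rangle}$, and $\|\cdot\|_1$ is the $\ell_1$ norm on $\mathbb R^m$. *)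

theory Defs
  imports "HOL-Probability.Probability" "Jordan_Normal_Form.Matrix"
begin

(* A tensor in R^{d_1 x ... x d_N} is a real function on multi-indices s with s i in {1..d i}
   for i in {1..N}.  Only its values on tensor_index N d are ever used. *)

type_synonym multi_index = "nat \<Rightarrow> nat"
type_synonym tensor = "multi_index \<Rightarrow> real"

definition tensor_index :: "nat \<Rightarrow> (nat \<Rightarrow> nat) \<Rightarrow> multi_index set" where
  "tensor_index N d = PiE {1..N} (\<lambda>i. {1..d i})"

definition tensor_inner :: "nat \<Rightarrow> (nat \<Rightarrow> nat) \<Rightarrow> tensor \<Rightarrow> tensor \<Rightarrow> real" where
  "tensor_inner N d X Y = (\<Sum>s\<in>tensor_index N d. X s * Y s)"

definition frob_norm :: "nat \<Rightarrow> (nat \<Rightarrow> nat) \<Rightarrow> tensor \<Rightarrow> real" where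
  "frob_norm N d X = sqrt (tensor_inner N d X X)"

(* Ranks are given by r 1, ..., r (N - 1); the convention r_0 = r_N = 1 is built in here, so the
   values of r outside {1..<N} are irrelevant. *)

definition tt_rank :: "nat \<Rightarrow> (nat \<Rightarrow> nat) \<Rightarrow> nat \<Rightarrow> nat" where
  "tt_rank N r i = (if i \<in> {1..<N} then r i else 1)"

(* mat_chain Y n = Y 1 * Y 2 * ... * Y n, for Y 1 with a single row. *)

primrec mat_chain :: "(nat \<Rightarrow> real mat) \<Rightarrow> nat \<Rightarrow> real mat" where
  "mat_chain Y 0 = 1\<^sub>m 1"
| "mat_chain Y (Suc n) = mat_chain Y n * Y (Suc n)"

(* F i k is the slice X_i(:, k, :) of the i-th factor.  The product of the slices is a 1 x 1
   matrix, identified with its entry; matrix entries are indexed from 0. *)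

definition tt_format :: "nat \<Rightarrow> (nat \<Rightarrow> nat) \<Rightarrow> (nat \<Rightarrow> nat) \<Rightarrow> tensor \<Rightarrow> bool" where
  "tt_format N d r X \<longleftrightarrow>
     (\<exists>F :: nat \<Rightarrow> nat \<Rightarrow> real mat.
        (\<forall>i\<in>{1..N}. \<forall>k\<in>{1..d i}. F i k \<in> carrier_mat (tt_rank N r (i - 1)) (tt_rank N r i)) \<and>
        (\<forall>s\<in>tensor_index N d. X s = mat_chain (\<lambda>i. F i (s i)) N $$ (0, 0)))"

(* The measurement tensors A_1, ..., A_m are stored as one array: A (k, s) = A_k(s). *)

type_synonym measurement = "nat \<times> multi_index \<Rightarrow> real"

definition measure_op :: "nat \<Rightarrow> (nat \<Rightarrow> nat) \<Rightarrow> measurement \<Rightarrow> tensor \<Rightarrow> nat \<Rightarrow> real" where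
  "measure_op N d A X k = tensor_inner N d (\<lambda>s. A (k, s)) X"

definition l1_norm :: "nat \<Rightarrow> (nat \<Rightarrow> real) \<Rightarrow> real" where
  "l1_norm m v = (\<Sum>k=1..m. \<bar>v k\<bar>)"

(* The joint law of the i.i.d. standard Gaussian entries of A_1, ..., A_m.  Using the law rather
   than random variables on a space M :: 'a measure keeps constants that are existentially
   quantified in a theorem independent of the type of sample points; iid_std_normal_iff_law
   shows that nothing is lost. *)

definition gaussian_measurement :: "nat \<Rightarrow> nat \<Rightarrow> (nat \<Rightarrow> nat) \<Rightarrow> measurement measure" where
  "gaussian_measurement m N d =
     PiM ({1..m} \<times> tensor_index N d) (\<lambda>_. density lborel std_normal_density)"

lemma (in prob_space) iid_std_normal_iff_law:
  fixes G :: "nat \<times> multi_index \<Rightarrow> 'a \<Rightarrow> real" and m N :: nat and d :: "nat \<Rightarrow> nat"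
  defines "I \<equiv> {1..m} \<times> tensor_index N d"
  assumes ne: "I \<noteq> {}"
  assumes rv: "\<And>i. i \<in> I \<Longrightarrow> random_variable borel (G i)"
  shows "(indep_vars (\<lambda>_. borel) G I \<and> (\<forall>i\<in>I. distributed M lborel (G i) std_normal_density))
     \<longleftrightarrow> distr M (gaussian_measurement m N d) (\<lambda>w. \<lambda>i\<in>I. G i w) = gaussian_measurement m N d"
    (is "?iid \<longleftrightarrow> ?law")
proof -
  let ?D = "density lborel std_normal_density :: real measure"
  have gm: "gaussian_measurement m N d = PiM I (\<lambda>_. ?D)"
    by (simp add: gaussian_measurement_def I_def)
  have sets_eq: "sets (PiM I (\<lambda>_. ?D)) = sets (PiM I (\<lambda>_. borel :: real measure))"
    by (intro sets_PiM_cong) auto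
  have D: "distributed M lborel (G i) std_normal_density \<longleftrightarrow> distr M borel (G i) = ?D"
    if "i \<in> I" for i
  proof -
    have "distr M lborel (G i) = distr M borel (G i)"
      by (intro distr_cong) auto
    then show ?thesis
      using rv[OF that] by (auto simp: distributed_def)
  qed
  have dm: "distr M (PiM I (\<lambda>_. ?D)) (\<lambda>w. \<lambda>i\<in>I. G i w)
      = distr M (PiM I (\<lambda>_. borel)) (\<lambda>w. \<lambda>i\<in>I. G i w)"
    by (intro distr_cong sets_eq) auto
  have indep: "indep_vars (\<lambda>_. borel) G I \<longleftrightarrow>
      distr M (PiM I (\<lambda>_. borel)) (\<lambda>w. \<lambda>i\<in>I. G i w) = PiM I (\<lambda>i. distr M borel (G i))"
    by (intro indep_vars_iff_distr_eq_PiM' ne rv)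
  show ?thesis
  proof
    assume iid: ?iid
    then have "PiM I (\<lambda>i. distr M borel (G i)) = PiM I (\<lambda>_. ?D)"
      using D by (intro PiM_cong) auto
    then show ?law
      using iid indep dm gm by simp
  next
    assume law: ?law
    interpret D: prob_space ?D
      by (rule prob_space_normal_density) simp
    have fm: "(\<lambda>w. \<lambda>i\<in>I. G i w) \<in> measurable M (PiM I (\<lambda>_. borel))"
      using rv by (intro measurable_restrict) auto
    have marg: "distr M borel (G i) = ?D" if i: "i \<in> I" for i
    proof -
      have "?D = distr (PiM I (\<lambda>_. ?D)) ?D (\<lambda>w. w i)"
        by (intro distr_PiM_component[symmetric] i) (auto intro: D.prob_space_axioms)
      also have "\<dots> = distr (distr M (PiM I (\<lambda>_. borel)) (\<lambda>w. \<lambda>i\<in>I. G i w)) borel (\<lambda>w. w i)"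
        using law dm gm by (intro distr_cong) auto
      also have "\<dots> = distr M borel (G i)"
        using i fm by (subst distr_distr) (auto simp: comp_def intro!: distr_cong)
      finally show ?thesis by simp
    qed
    then have "PiM I (\<lambda>i. distr M borel (G i)) = PiM I (\<lambda>_. ?D)"
      by (intro PiM_cong) auto
    then have "indep_vars (\<lambda>_. borel) G I"
      using indep law dm gm by simp
    then show ?iid
      using D marg by blast
  qed
qed

end

theory Submission
  imports Defs
begin

text \<open>
  Write \<open>f X = 1/m * l1_norm m (A X) - sqrt (2/pi) * norm X\<close>. Gram-Schmidt brings a tensor train into a
  left-contractive form, in which its cores can be rounded to a grid. Rounding each row greedily makes
  the error depend on the Frobenius norm of the chain to the right only, so that for every
  \<open>\<epsilon>\<close> the tensors of unit norm have an \<open>\<epsilon>\<close>-net of size \<open>(128 N / \<epsilon>) ^ Q\<close> with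
  \<open>Q = N * dmax * rmax\<^sup>2\<close>.

  The increments of \<open>f\<close> are subgaussian: for \<open>Z = \<bar>g\<bar> - \<bar>g'\<bar>\<close> with \<open>g, g'\<close> jointly Gaussian,
  \<open>E exp (l (Z - E Z)) \<le> E exp (l Z) * E exp (- l Z) \<le> E cosh (2 l Z) \<le> E cosh (2 l (g - g'))\<close>.
  A union bound at a single scale \<open>\<epsilon>\<close> of order \<open>\<delta>\<close> would lose a factor \<open>ln (1 / \<delta>)\<close>; chaining over
  the scales \<open>2 ^ (- j)\<close>, with increments allowed to be \<open>\<delta> / 4 * (3 / 4) ^ j\<close>, does not.
\<close>

section \<open>Left-contractive tensor trains\<close>

text \<open>Contractive cores are the normal form because operator norm at most 1 keeps the rounding
  error of one core from being amplified by the next ones. With an error of about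
  \<open>\<epsilon> / (2 N)\<close> per core the errors essentially add up; this is the origin of
  the \<open>N\<close> in the size of the net, and so of \<open>ln N\<close> in the theorem. The
  obstacle is to avoid a logarithm of dimensions and ranks in the entropy. The error bound forces a
  mesh of about \<open>\<eta> / sqrt (dmax * rmax)\<close>, and counting the grid points of a box
  would produce that logarithm. But the Frobenius norm of a contractive core is at most the square
  root of its rank, so its entries are on average only about \<open>1 / \<eta>\<close> meshes large.
  The integer arrays therefore lie in an l1 ball of radius proportional to
  \<open>Q / \<eta>\<close>, which has only \<open>(const / \<eta>) ^ Q\<close> integer points. In
  the chaining, the squared ratio of allowed increment to distance grows like
  \<open>(9 / 4) ^ j\<close>, while the entropy at scale \<open>j\<close> is at most of order
  \<open>(j + 1) * Q * ln N\<close>. Hence \<open>m\<close> has to beat the entropy of the coarsest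
  scale only, \<open>Q * ln N\<close> up to a constant.\<close>

lemma sum_PiE_insert:
  fixes g :: "('a \<Rightarrow> 'b) \<Rightarrow> 'c :: comm_monoid_add"
  assumes "i \<notin> I"
  shows "(\<Sum>s\<in>PiE (insert i I) D. g s) = (\<Sum>k\<in>D i. \<Sum>s\<in>PiE I D. g (s(i := k)))"
  unfolding PiE_insert_eq sum.reindex[OF inj_combinator[OF assms]]
  by (simp add: sum.cartesian_product case_prod_beta comp_def)

section \<open>Orthogonal families and Gram-Schmidt\<close>

lemma sum_orthogonal_product:
  fixes f :: "nat \<Rightarrow> 'a \<Rightarrow> real"
  assumes orth: "\<And>a b. a < n \<Longrightarrow> b < n \<Longrightarrow> a \<noteq> b \<Longrightarrow> (\<Sum>s\<in>S. f a s * f b s) = 0"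
  shows "(\<Sum>s\<in>S. (\<Sum>a<n. x a * f a s) * (\<Sum>a<n. y a * f a s))
       = (\<Sum>a<n. x a * y a * (\<Sum>s\<in>S. (f a s)\<^sup>2))"
proof -
  have "(\<Sum>s\<in>S. (\<Sum>a<n. x a * f a s) * (\<Sum>a<n. y a * f a s))
      = (\<Sum>s\<in>S. \<Sum>a<n. \<Sum>b<n. x a * y b * (f a s * f b s))"
    by (simp add: sum_product mult_ac)
  also have "\<dots> = (\<Sum>a<n. \<Sum>s\<in>S. \<Sum>b<n. x a * y b * (f a s * f b s))"
    by (rule sum.swap)
  also have "\<dots> = (\<Sum>a<n. \<Sum>b<n. \<Sum>s\<in>S. x a * y b * (f a s * f b s))"
    by (intro sum.cong refl sum.swap)
  also have "\<dots> = (\<Sum>a<n. \<Sum>b<n. x a * y b * (\<Sum>s\<in>S. f a s * f b s))"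
    by (simp add: sum_distrib_left)
  also have "\<dots> = (\<Sum>a<n. \<Sum>b<n. if b = a then x a * y b * (\<Sum>s\<in>S. f a s * f b s) else 0)"
    by (intro sum.cong refl) (use orth in auto)
  also have "\<dots> = (\<Sum>a<n. x a * y a * (\<Sum>s\<in>S. (f a s)\<^sup>2))"
    by (intro sum.cong refl) (simp add: power2_eq_square)
  finally show ?thesis .
qed

text \<open>The family keeps its length: a vector that depends on its predecessors contributes
  \<open>q i = 0\<close>, so the norms are 0 or 1 and linear independence is not assumed. Vanishing
  off \<open>I\<close> lets sums over a larger index set be cut down to \<open>I\<close>
  later.\<close>

lemma gram_schmidt_ex:
  fixes b :: "nat \<Rightarrow> 'a \<Rightarrow> real"
  assumes fin: "finite I"
  shows "\<exists>q. (\<forall>i<n. \<forall>j<n. i \<noteq> j \<longrightarrow> (\<Sum>x\<in>I. q i x * q j x) = 0) \<and>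
             (\<forall>i<n. (\<Sum>x\<in>I. (q i x)\<^sup>2) \<in> {0, 1}) \<and>
             (\<forall>j<n. \<forall>x\<in>I. b j x = (\<Sum>i<n. (\<Sum>y\<in>I. q i y * b j y) * q i x)) \<and>
             (\<forall>i. \<forall>x. x \<notin> I \<longrightarrow> q i x = 0)"
proof (induction n)
  case 0
  show ?case by (intro exI[of _ "\<lambda>_ _. 0"]) auto
next
  case (Suc n)
  then obtain q where orth: "\<And>i j. i < n \<Longrightarrow> j < n \<Longrightarrow> i \<noteq> j \<Longrightarrow> (\<Sum>x\<in>I. q i x * q j x) = 0"
    and nrm: "\<And>i. i < n \<Longrightarrow> (\<Sum>x\<in>I. (q i x)\<^sup>2) \<in> {0, 1}"
    and ex: "\<And>j x. j < n \<Longrightarrow> x \<in> I \<Longrightarrow> b j x = (\<Sum>i<n. (\<Sum>y\<in>I. q i y * b j y) * q i x)"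
    and out: "\<And>i x. x \<notin> I \<Longrightarrow> q i x = 0"
  proof (elim exE conjE, goal_cases)
    case (1 q)
    show ?case by (rule 1(1)[of q]) (use 1(2-5) in blast)+
  qed
  define c where "c i = (\<Sum>y\<in>I. q i y * b n y)" for i
  define res where "res x = b n x - (\<Sum>i<n. c i * q i x)" for x
  have perp: "(\<Sum>x\<in>I. q j x * res x) = 0" if j: "j < n" for j
  proof -
    have "(\<Sum>x\<in>I. q j x * (\<Sum>i<n. c i * q i x)) = (\<Sum>x\<in>I. \<Sum>i<n. c i * (q j x * q i x))"
      by (simp add: sum_distrib_left mult_ac)
    also have "\<dots> = (\<Sum>i<n. c i * (\<Sum>x\<in>I. q j x * q i x))"
      by (subst sum.swap) (simp add: sum_distrib_left)
    also have "\<dots> = (\<Sum>i<n. if i = j then c j * (\<Sum>x\<in>I. q j x * q j x) else 0)"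
      by (intro sum.cong refl) (use orth j in auto)
    also have "\<dots> = c j * (\<Sum>x\<in>I. (q j x)\<^sup>2)"
      using j by (simp add: power2_eq_square)
    also have "\<dots> = c j"
    \<comment> \<open>A zero vector \<open>q j\<close> has coefficient \<open>c j = 0\<close>, so it
      does not disturb the orthogonality of the residual.\<close>
    proof (cases "(\<Sum>x\<in>I. (q j x)\<^sup>2) = 0")
      case True
      then have "\<forall>x\<in>I. q j x = 0"
        using fin by (subst (asm) sum_nonneg_eq_0_iff) auto
      then have "c j = 0" by (simp add: c_def)
      then show ?thesis by simp
    next
      case False
      then show ?thesis using nrm[OF j] by auto
    qed
    finally show ?thesis
      by (simp add: res_def right_diff_distrib sum_subtractf c_def)
  qed
  define \<nu> where "\<nu> = (\<Sum>x\<in>I. (res x)\<^sup>2)"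
  have \<nu>0: "\<nu> \<ge> 0" by (simp add: \<nu>_def sum_nonneg)
  have res0: "res x = 0" if "\<nu> = 0" "x \<in> I" for x
    using that fin unfolding \<nu>_def by (subst (asm) sum_nonneg_eq_0_iff) auto
  \<comment> \<open>For \<open>\<nu> = 0\<close> division by zero makes \<open>p\<close> the zero vector, as wanted.\<close>
  define p where "p x = (if x \<in> I then res x / sqrt \<nu> else 0)" for x
  define q' where "q' = q(n := p)"
  have q': "q' i = q i" if "i < n" for i using that by (simp add: q'_def)
  have q'n: "q' n = p" by (simp add: q'_def)
  have psum: "(\<Sum>x\<in>I. p x * g x) = (\<Sum>x\<in>I. res x * g x) / sqrt \<nu>" for g
    by (simp add: p_def sum_divide_distrib)
  have pp: "(\<Sum>x\<in>I. q i x * p x) = 0" "(\<Sum>x\<in>I. p x * q i x) = 0" if "i < n" for i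
  proof -
    show "(\<Sum>x\<in>I. p x * q i x) = 0"
      using psum[of "q i"] perp[OF that] by (simp add: mult.commute)
    then show "(\<Sum>x\<in>I. q i x * p x) = 0" by (simp add: mult.commute)
  qed
  \<comment> \<open>The earlier \<open>b j\<close> are combinations of the earlier
    \<open>q i\<close>; hence the summand that the new vector adds to their expansions is 0.\<close>
  have pb: "(\<Sum>x\<in>I. p x * b j x) = 0" if j: "j < n" for j
  proof -
    have "(\<Sum>x\<in>I. p x * b j x) = (\<Sum>x\<in>I. \<Sum>i<n. (\<Sum>y\<in>I. q i y * b j y) * (p x * q i x))"
      using ex[OF j] by (intro sum.cong refl) (simp add: sum_distrib_left mult_ac)
    also have "\<dots> = (\<Sum>i<n. (\<Sum>y\<in>I. q i y * b j y) * (\<Sum>x\<in>I. p x * q i x))"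
      by (subst sum.swap) (simp add: sum_distrib_left)
    also have "\<dots> = 0" using pp by simp
    finally show ?thesis .
  qed
  \<comment> \<open>The residual is orthogonal to the part of \<open>b n\<close> already expanded,
    so the coefficient of \<open>b n\<close> along \<open>p\<close> is
    \<open>\<nu> / sqrt \<nu> = sqrt \<nu>\<close>.\<close>
  have rb: "(\<Sum>x\<in>I. res x * b n x) = \<nu>"
  proof -
    have "(\<Sum>x\<in>I. res x * (\<Sum>i<n. c i * q i x)) = (\<Sum>i<n. c i * (\<Sum>x\<in>I. q i x * res x))"
      by (simp add: sum_distrib_left, subst sum.swap) (simp add: mult_ac)
    also have "\<dots> = 0" using perp by simp
    finally have *: "(\<Sum>x\<in>I. res x * (\<Sum>i<n. c i * q i x)) = 0" .
    have "(\<Sum>x\<in>I. res x * b n x) = (\<Sum>x\<in>I. (res x)\<^sup>2 + res x * (\<Sum>i<n. c i * q i x))"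
      by (intro sum.cong refl) (simp add: res_def power2_eq_square algebra_simps)
    then show ?thesis using * by (simp add: sum.distrib \<nu>_def)
  qed
  have 1: "(\<Sum>x\<in>I. q' i x * q' j x) = 0" if "i < Suc n" "j < Suc n" "i \<noteq> j" for i j
    using that orth pp by (cases "i = n"; cases "j = n") (auto simp: q' q'n less_Suc_eq)
  have 2: "(\<Sum>x\<in>I. (q' i x)\<^sup>2) \<in> {0, 1}" if "i < Suc n" for i
  proof (cases "i = n")
    case True
    have "(\<Sum>x\<in>I. (p x)\<^sup>2) = \<nu> / \<nu>"
      using \<nu>0 by (simp add: p_def power_divide \<nu>_def[symmetric] sum_divide_distrib[symmetric])
    then show ?thesis using True by (auto simp: q'n)
  next
    case False
    then show ?thesis using that nrm[of i] by (auto simp: q')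
  qed
  have 3: "b j x = (\<Sum>i<Suc n. (\<Sum>y\<in>I. q' i y * b j y) * q' i x)" if "j < Suc n" "x \<in> I" for j x
  proof (cases "j = n")
    case True
    have "(\<Sum>y\<in>I. p y * b n y) = sqrt \<nu>"
      using \<nu>0 by (simp add: psum rb real_div_sqrt)
    then have "(\<Sum>y\<in>I. p y * b n y) * p x = res x"
      using res0[of x] that by (simp add: p_def)
    then show ?thesis using True by (simp add: q' q'n res_def c_def)
  next
    case False
    then have "j < n" using that by simp
    then show ?thesis using ex[of j x] that pb[of j] by (simp add: q' q'n)
  qed
  have 4: "q' i x = 0" if "x \<notin> I" for i x
    using that out by (simp add: q'_def p_def)
  show ?case
    by (rule exI[of _ q']) (use 1 2 3 4 in blast)
qed

lemma gram_schmidt: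
  fixes b :: "nat \<Rightarrow> 'a \<Rightarrow> real"
  assumes "finite I"
  obtains q where
    "\<And>i j. i < n \<Longrightarrow> j < n \<Longrightarrow> i \<noteq> j \<Longrightarrow> (\<Sum>x\<in>I. q i x * q j x) = 0"
    "\<And>i. i < n \<Longrightarrow> (\<Sum>x\<in>I. (q i x)\<^sup>2) \<in> {0, 1}"
    "\<And>j x. j < n \<Longrightarrow> x \<in> I \<Longrightarrow> b j x = (\<Sum>i<n. (\<Sum>y\<in>I. q i y * b j y) * q i x)"
    "\<And>i x. x \<notin> I \<Longrightarrow> q i x = 0"
  using gram_schmidt_ex[OF assms, of n b]
proof (elim exE conjE, goal_cases)
  case (1 q)
  show ?case by (rule 1(1)[of q]) (use 1(2-5) in blast)+
qed

text \<open>This is operator norm at most 1 for the unfolding with rows \<open>(k, a)\<close> and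
  columns \<open>b\<close>. Orthonormal columns would be too much to ask, because the zero columns
  that keep the ranks fixed have to be allowed.\<close>

definition contractive :: "nat set \<Rightarrow> nat \<Rightarrow> nat \<Rightarrow> (nat \<Rightarrow> nat \<Rightarrow> nat \<Rightarrow> real) \<Rightarrow> bool" where
  "contractive K p q X \<longleftrightarrow>
     (\<forall>v. (\<Sum>k\<in>K. \<Sum>a<p. (\<Sum>b<q. X k a b * v b)\<^sup>2) \<le> (\<Sum>b<q. (v b)\<^sup>2))"

text \<open>\<open>mat_chain\<close> with index functions in place of matrices, so that cores can be
  replaced or rounded without carrier conditions. The start is a unit vector because
  \<open>q 0 = 1\<close>.\<close>

primrec tt_row :: "(nat \<Rightarrow> nat) \<Rightarrow> (nat \<Rightarrow> nat \<Rightarrow> nat \<Rightarrow> nat \<Rightarrow> real) \<Rightarrow> nat \<Rightarrow> multi_index \<Rightarrow> nat \<Rightarrow> real"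
where
  "tt_row q G 0 s b = (if b = 0 then 1 else 0)"
| "tt_row q G (Suc n) s b = (\<Sum>a<q n. tt_row q G n s a * G (Suc n) (s (Suc n)) a b)"

lemma tt_row_cong:
  assumes "\<And>i a b. i \<in> {1..n} \<Longrightarrow> a < q (i - 1) \<Longrightarrow> b < q i \<Longrightarrow> G i (s i) a b = G' i (s' i) a b"
    and "b < q n"
  shows "tt_row q G n s b = tt_row q G' n s' b"
  using assms
proof (induction n arbitrary: b)
  case (Suc n)
  have "G (Suc n) (s (Suc n)) a b = G' (Suc n) (s' (Suc n)) a b" if "a < q n" for a
    using Suc.prems(1)[of "Suc n" a b] Suc.prems(2) that by simp
  moreover have "tt_row q G n s a = tt_row q G' n s' a" if "a < q n" for a
    by (rule Suc.IH) (use Suc.prems(1) that in auto)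
  ultimately show ?case by simp
qed simp

lemma mat_chain_eq_tt_row:
  assumes "q 0 = 1" "\<And>i. i \<in> {1..n} \<Longrightarrow> F i (s i) \<in> carrier_mat (q (i - 1)) (q i)"
  shows "mat_chain (\<lambda>i. F i (s i)) n \<in> carrier_mat 1 (q n) \<and>
    (\<forall>b<q n. mat_chain (\<lambda>i. F i (s i)) n $$ (0, b) = tt_row q (\<lambda>i k a b. F i k $$ (a, b)) n s b)"
  using assms(2)
proof (induction n)
  case 0
  show ?case using assms(1) by simp
next
  case (Suc n)
  then have IH: "mat_chain (\<lambda>i. F i (s i)) n \<in> carrier_mat 1 (q n)"
    "\<And>b. b < q n \<Longrightarrow> mat_chain (\<lambda>i. F i (s i)) n $$ (0, b) = tt_row q (\<lambda>i k a b. F i k $$ (a, b)) n s b"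
    by auto
  have F: "F (Suc n) (s (Suc n)) \<in> carrier_mat (q n) (q (Suc n))"
    using Suc.prems[of "Suc n"] by simp
  have "mat_chain (\<lambda>i. F i (s i)) (Suc n) $$ (0, b)
      = tt_row q (\<lambda>i k a b. F i k $$ (a, b)) (Suc n) s b" if "b < q (Suc n)" for b
    using IH F that by (simp add: scalar_prod_def atLeast0LessThan)
  then show ?case using IH(1) F by auto
qed

text \<open>Carrying out Gram-Schmidt from the left, with zero vectors kept instead of being discarded so that
  the ranks do not change. The matrix \<open>R\<close> has to annihilate those zero columns, for otherwise
  the vectors produced at the next step would not remain orthogonal after applying the chain.\<close>

lemma left_contractive_form:
  fixes d q :: "nat \<Rightarrow> nat"
  assumes q0: "q 0 = 1"
  defines "S \<equiv> \<lambda>n. PiE {1..n} (\<lambda>i. {1..d i})"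
  shows "\<exists>U R. (\<forall>i\<in>{1..n}. contractive {1..d i} (q (i - 1)) (q i) (U i)) \<and>
    (\<forall>b<q n. \<forall>c<q n. b \<noteq> c \<longrightarrow> (\<Sum>s\<in>S n. tt_row q U n s b * tt_row q U n s c) = 0) \<and>
    (\<forall>b<q n. (\<Sum>s\<in>S n. (tt_row q U n s b)\<^sup>2) \<in> {0, 1}) \<and>
    (\<forall>c<q n. (\<Sum>s\<in>S n. (tt_row q U n s c)\<^sup>2) = 0 \<longrightarrow> (\<forall>b. R c b = 0)) \<and>
    (\<forall>s. (\<forall>i\<in>{1..n}. s i \<in> {1..d i}) \<longrightarrow>
       (\<forall>b<q n. tt_row q G n s b = (\<Sum>c<q n. tt_row q U n s c * R c b)))"
proof (induction n)
  case 0
  show ?case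
    by (rule exI[of _ "\<lambda>_ _ _ _. 0"], rule exI[of _ "\<lambda>c b. if c = 0 \<and> b = 0 then 1 else 0"])
       (auto simp: q0 S_def)
next
  case (Suc n)
  then obtain U R where contr: "\<And>i. i \<in> {1..n} \<Longrightarrow> contractive {1..d i} (q (i - 1)) (q i) (U i)"
    and orth: "\<And>b c. b < q n \<Longrightarrow> c < q n \<Longrightarrow> b \<noteq> c \<Longrightarrow> (\<Sum>s\<in>S n. tt_row q U n s b * tt_row q U n s c) = 0"
    and nrm: "\<And>b. b < q n \<Longrightarrow> (\<Sum>s\<in>S n. (tt_row q U n s b)\<^sup>2) \<in> {0, 1}"
    and ann: "\<And>c b. c < q n \<Longrightarrow> (\<Sum>s\<in>S n. (tt_row q U n s c)\<^sup>2) = 0 \<Longrightarrow> R c b = 0"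
    and expand: "\<And>s b. (\<forall>i\<in>{1..n}. s i \<in> {1..d i}) \<Longrightarrow> b < q n \<Longrightarrow>
        tt_row q G n s b = (\<Sum>c<q n. tt_row q U n s c * R c b)"
  proof (elim exE conjE, goal_cases)
    case (1 U R)
    show ?case by (rule 1(1)[of U R]) (use 1(2-6) in blast)+
  qed
  define J where "J = {a. (\<Sum>s\<in>S n. (tt_row q U n s a)\<^sup>2) = 0}"
  \<comment> \<open>Gram-Schmidt sees only the rows \<open>(k, a)\<close> whose column
    \<open>a\<close> of the chain is nonzero: the chain acts isometrically on these and kills the
    others.\<close>
  define I where "I = {1..d (Suc n)} \<times> ({..<q n} - J)"
  have finI: "finite I" by (simp add: I_def)
  \<comment> \<open>The factor \<open>R\<close> left over from the previous step is absorbed into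
    the next core before that core is orthogonalised.\<close>
  define B where "B b y = (\<Sum>c<q n. R (snd y) c * G (Suc n) (fst y) c b)" for b and y :: "nat \<times> nat"
  obtain w where
      worth: "\<And>i j. i < q (Suc n) \<Longrightarrow> j < q (Suc n) \<Longrightarrow> i \<noteq> j \<Longrightarrow> (\<Sum>x\<in>I. w i x * w j x) = 0"
    and wnrm: "\<And>i. i < q (Suc n) \<Longrightarrow> (\<Sum>x\<in>I. (w i x)\<^sup>2) \<in> {0, 1}"
    and wex: "\<And>j x. j < q (Suc n) \<Longrightarrow> x \<in> I \<Longrightarrow> B j x = (\<Sum>i<q (Suc n). (\<Sum>y\<in>I. w i y * B j y) * w i x)"
    and wout: "\<And>i x. x \<notin> I \<Longrightarrow> w i x = 0"
  proof (rule gram_schmidt[OF finI, where n = "q (Suc n)" and b = B], goal_cases)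
    case (1 w)
    show ?case by (rule 1(1)[of w]) (fact 1(2-5))+
  qed
  define U' where "U' = U(Suc n := \<lambda>k a b. w b (k, a))"
  define R' where "R' c b = (\<Sum>y\<in>I. w c y * B b y)" for c b
  have sumI: "(\<Sum>k\<in>{1..d (Suc n)}. \<Sum>a<q n. g (k, a)) = (\<Sum>y\<in>I. g y)"
    if "\<And>y. y \<notin> I \<Longrightarrow> g y = 0" for g :: "nat \<times> nat \<Rightarrow> real"
  proof -
    have "(\<Sum>k\<in>{1..d (Suc n)}. \<Sum>a<q n. g (k, a)) = (\<Sum>y\<in>{1..d (Suc n)} \<times> {..<q n}. g y)"
      by (simp add: sum.cartesian_product)
    also have "\<dots> = (\<Sum>y\<in>I. g y)"
      by (rule sum.mono_neutral_right) (auto simp: I_def that)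
    finally show ?thesis .
  qed
  have row': "tt_row q U' (Suc n) s b = (\<Sum>a<q n. tt_row q U n s a * w b (s (Suc n), a))" for s b
  proof -
    have "tt_row q U' n s a = tt_row q U n s a" if "a < q n" for a
      by (rule tt_row_cong) (use that in \<open>simp_all add: U'_def\<close>)
    then show ?thesis by (simp add: U'_def)
  qed
  have S': "S (Suc n) = PiE (insert (Suc n) {1..n}) (\<lambda>i. {1..d i})"
    by (simp add: S_def atLeastAtMostSuc_conv)
  have upd: "tt_row q U n (s(Suc n := k)) a = tt_row q U n s a" if "a < q n" for s k a
    by (rule tt_row_cong) (use that in auto)
  \<comment> \<open>The columns of the shorter chain have a diagonal Gram matrix with entries 0 and
    1, and \<open>w\<close> vanishes where the entry is 0. The matrix thus acts as the identity, and
    the new columns inherit the inner products of \<open>w\<close>.\<close>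
  have gram: "(\<Sum>s\<in>S (Suc n). tt_row q U' (Suc n) s b * tt_row q U' (Suc n) s c) = (\<Sum>y\<in>I. w b y * w c y)"
    for b c
  proof -
    have "(\<Sum>s\<in>S (Suc n). tt_row q U' (Suc n) s b * tt_row q U' (Suc n) s c)
        = (\<Sum>k\<in>{1..d (Suc n)}. \<Sum>s\<in>S n. (\<Sum>a<q n. w b (k, a) * tt_row q U n s a)
             * (\<Sum>a<q n. w c (k, a) * tt_row q U n s a))"
      unfolding S' by (subst sum_PiE_insert) (simp_all add: row' upd S_def mult.commute del: tt_row.simps)
    also have "\<dots> = (\<Sum>k\<in>{1..d (Suc n)}. \<Sum>a<q n. w b (k, a) * w c (k, a) * (\<Sum>s\<in>S n. (tt_row q U n s a)\<^sup>2))"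
      by (intro sum.cong refl sum_orthogonal_product orth)
    also have "\<dots> = (\<Sum>k\<in>{1..d (Suc n)}. \<Sum>a<q n. w b (k, a) * w c (k, a))"
    proof (intro sum.cong refl)
      fix k a assume ka: "k \<in> {1..d (Suc n)}" "a \<in> {..<q n}"
      show "w b (k, a) * w c (k, a) * (\<Sum>s\<in>S n. (tt_row q U n s a)\<^sup>2) = w b (k, a) * w c (k, a)"
      proof (cases "a \<in> J")
        case True
        then show ?thesis using wout[of "(k, a)"] by (simp add: I_def)
      next
        case False
        then show ?thesis using nrm[of a] ka by (auto simp: J_def)
      qed
    qed
    also have "\<dots> = (\<Sum>y\<in>I. w b y * w c y)"
      by (rule sumI) (simp add: wout)
    finally show ?thesis .
  qed
  have gram2: "(\<Sum>s\<in>S (Suc n). (tt_row q U' (Suc n) s b)\<^sup>2) = (\<Sum>y\<in>I. (w b y)\<^sup>2)" for b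
    using gram[of b b] by (simp only: power2_eq_square)
  have 1: "contractive {1..d i} (q (i - 1)) (q i) (U' i)" if "i \<in> {1..Suc n}" for i
  proof (cases "i = Suc n")
    case True
    have "(\<Sum>k\<in>{1..d (Suc n)}. \<Sum>a<q n. (\<Sum>b<q (Suc n). w b (k, a) * v b)\<^sup>2) \<le> (\<Sum>b<q (Suc n). (v b)\<^sup>2)" for v
    proof -
      have "(\<Sum>k\<in>{1..d (Suc n)}. \<Sum>a<q n. (\<Sum>b<q (Suc n). w b (k, a) * v b)\<^sup>2)
          = (\<Sum>y\<in>I. (\<Sum>b<q (Suc n). w b y * v b)\<^sup>2)"
        by (rule sumI) (simp add: wout)
      also have "\<dots> = (\<Sum>y\<in>I. (\<Sum>b<q (Suc n). v b * w b y) * (\<Sum>b<q (Suc n). v b * w b y))"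
        by (simp add: power2_eq_square mult.commute)
      also have "\<dots> = (\<Sum>b<q (Suc n). v b * v b * (\<Sum>y\<in>I. (w b y)\<^sup>2))"
        by (intro sum_orthogonal_product worth)
      also have "\<dots> \<le> (\<Sum>b<q (Suc n). (v b)\<^sup>2)"
      proof (rule sum_mono)
        fix b assume "b \<in> {..<q (Suc n)}"
        then have "(\<Sum>y\<in>I. (w b y)\<^sup>2) \<le> 1" using wnrm[of b] by auto
        then show "v b * v b * (\<Sum>y\<in>I. (w b y)\<^sup>2) \<le> (v b)\<^sup>2"
          using mult_left_mono[of "\<Sum>y\<in>I. (w b y)\<^sup>2" 1 "v b * v b"] by (simp add: power2_eq_square)
      qed
      finally show ?thesis .
    qed
    then show ?thesis using True by (simp add: contractive_def U'_def)
  next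
    case False
    then show ?thesis using that contr[of i] by (simp add: U'_def)
  qed
  have 4: "R' c b = 0" if "(\<Sum>s\<in>S (Suc n). (tt_row q U' (Suc n) s c)\<^sup>2) = 0" for c b
  proof -
    have "\<forall>y\<in>I. w c y = 0"
      using that finI unfolding gram2 by (subst (asm) sum_nonneg_eq_0_iff) auto
    then show ?thesis by (simp add: R'_def)
  qed
  have 5: "tt_row q G (Suc n) s b = (\<Sum>c<q (Suc n). tt_row q U' (Suc n) s c * R' c b)"
    if s: "\<forall>i\<in>{1..Suc n}. s i \<in> {1..d i}" and b: "b < q (Suc n)" for s b
  proof -
    let ?k = "s (Suc n)"
    have "tt_row q G (Suc n) s b
        = (\<Sum>a<q n. \<Sum>c<q n. tt_row q U n s c * (R c a * G (Suc n) ?k a b))"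
      using s by (simp add: expand sum_distrib_left sum_distrib_right mult_ac)
    also have "\<dots> = (\<Sum>c<q n. tt_row q U n s c * B b (?k, c))"
      by (subst sum.swap) (simp add: B_def sum_distrib_left)
    also have "\<dots> = (\<Sum>c<q n. tt_row q U n s c * (\<Sum>e<q (Suc n). R' e b * w e (?k, c)))"
    proof (intro sum.cong refl)
      fix c assume c: "c \<in> {..<q n}"
      have "B b (?k, c) = (\<Sum>e<q (Suc n). R' e b * w e (?k, c))"
      \<comment> \<open>For \<open>c \<in> J\<close> both sides are 0: \<open>R\<close> annihilates
        this column, and \<open>w\<close> vanishes off \<open>I\<close>.\<close>
      proof (cases "c \<in> J")
        case True
        then show ?thesis using c by (simp add: B_def ann J_def wout I_def)
      next
        case False
        then have "(?k, c) \<in> I" using c s by (auto simp: I_def)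
        then show ?thesis using wex[OF b, of "(?k, c)"] by (simp add: R'_def)
      qed
      then show "tt_row q U n s c * B b (?k, c)
        = tt_row q U n s c * (\<Sum>e<q (Suc n). R' e b * w e (?k, c))" by simp
    qed
    also have "\<dots> = (\<Sum>c<q n. \<Sum>e<q (Suc n). tt_row q U n s c * w e (?k, c) * R' e b)"
      by (simp add: sum_distrib_left mult_ac)
    also have "\<dots> = (\<Sum>e<q (Suc n). tt_row q U' (Suc n) s e * R' e b)"
      by (subst sum.swap) (simp add: row' sum_distrib_right del: tt_row.simps)
    finally show ?thesis .
  qed
  show ?case
    by (rule exI[of _ U'], rule exI[of _ R'])
       (use 1 4 5 gram gram2 worth wnrm in \<open>auto simp del: tt_row.simps\<close>)
qed

section \<open>Splitting the Frobenius norm off a tensor train\<close>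

lemma frob_norm_eq_L2_set: "frob_norm N d X = L2_set X (tensor_index N d)"
  by (simp add: frob_norm_def tensor_inner_def L2_set_def power2_eq_square)

lemma finite_tensor_index: "finite (tensor_index N d)"
  by (auto simp: tensor_index_def intro: finite_PiE)

lemma tt_rank_0: "tt_rank N r 0 = 1" and tt_rank_N: "tt_rank N r N = 1"
  by (simp_all add: tt_rank_def)

text \<open>As the last rank is 1, the final factor \<open>R\<close> is a number, and it carries the
  whole norm. If the remaining column has norm 0 then \<open>R\<close> annihilates it, so
  \<open>\<bar>\<rho>\<bar>\<close> is the norm of \<open>X\<close> even for zero tensors; that case
  is why the chain has norm at most 1 and not equal to 1.\<close>

lemma tt_format_contractive:
  assumes "tt_format N d r X"
  obtains U \<rho> where
    "\<And>i. i \<in> {1..N} \<Longrightarrow> contractive {1..d i} (tt_rank N r (i - 1)) (tt_rank N r i) (U i)"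
    "\<And>s. s \<in> tensor_index N d \<Longrightarrow> X s = \<rho> * tt_row (tt_rank N r) U N s 0"
    "\<bar>\<rho>\<bar> = frob_norm N d X"
    "frob_norm N d (\<lambda>s. tt_row (tt_rank N r) U N s 0) \<le> 1"
proof -
  define q where "q = tt_rank N r"
  have q0: "q 0 = 1" and qN: "q N = 1" by (simp_all add: q_def tt_rank_0 tt_rank_N)
  obtain F where F: "\<And>i k. i \<in> {1..N} \<Longrightarrow> k \<in> {1..d i} \<Longrightarrow> F i k \<in> carrier_mat (q (i - 1)) (q i)"
    and X: "\<And>s. s \<in> tensor_index N d \<Longrightarrow> X s = mat_chain (\<lambda>i. F i (s i)) N $$ (0, 0)"
    using assms unfolding tt_format_def q_def[symmetric] by blast
  define G where "G = (\<lambda>i k a b. F i k $$ (a, b))"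
  have XG: "X s = tt_row q G N s 0" if s: "s \<in> tensor_index N d" for s
  proof -
    have "F i (s i) \<in> carrier_mat (q (i - 1)) (q i)" if "i \<in> {1..N}" for i
      using F[OF that] s that by (auto simp: tensor_index_def PiE_def Pi_def)
    from mat_chain_eq_tt_row[of q N F s, OF q0 this] show ?thesis
      using X[OF s] qN by (simp add: G_def)
  qed
  obtain U and R :: "nat \<Rightarrow> nat \<Rightarrow> real" where U: "\<And>i. i \<in> {1..N} \<Longrightarrow> contractive {1..d i} (q (i - 1)) (q i) (U i)"
    and nrm: "(\<Sum>s\<in>tensor_index N d. (tt_row q U N s 0)\<^sup>2) \<in> {0, 1}"
    and ann: "(\<Sum>s\<in>tensor_index N d. (tt_row q U N s 0)\<^sup>2) = 0 \<Longrightarrow> R 0 0 = (0::real)"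
    and ex: "\<And>s. (\<forall>i\<in>{1..N}. s i \<in> {1..d i}) \<Longrightarrow> tt_row q G N s 0 = tt_row q U N s 0 * R 0 0"
    using left_contractive_form[where q = q and n = N and d = d and G = G, OF q0]
    unfolding tensor_index_def[symmetric]
  proof (elim exE conjE, goal_cases)
    case (1 U R)
    show ?case
    proof (rule 1(1)[of U R])
      show "\<And>i. i \<in> {1..N} \<Longrightarrow> contractive {1..d i} (q (i - 1)) (q i) (U i)"
        using 1(2) by blast
      show "(\<Sum>s\<in>tensor_index N d. (tt_row q U N s 0)\<^sup>2) \<in> {0, 1}"
        using 1(4) qN by simp
      show "R 0 0 = 0" if "(\<Sum>s\<in>tensor_index N d. (tt_row q U N s 0)\<^sup>2) = 0"
        using 1(5) qN that by simp
      show "tt_row q G N s 0 = tt_row q U N s 0 * R 0 0" if "\<forall>i\<in>{1..N}. s i \<in> {1..d i}" for s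
        using 1(6)[rule_format, of s 0] qN that by simp
    qed
  qed
  have XU: "X s = R 0 0 * tt_row q U N s 0" if s: "s \<in> tensor_index N d" for s
  proof -
    have "\<forall>i\<in>{1..N}. s i \<in> {1..d i}" using s by (auto simp: tensor_index_def PiE_def Pi_def)
    then show ?thesis using ex[of s] XG[OF s] by simp
  qed
  have "frob_norm N d X = L2_set (\<lambda>s. R 0 0 * tt_row q U N s 0) (tensor_index N d)"
    unfolding frob_norm_eq_L2_set by (intro L2_set_cong refl XU)
  also have "\<dots> = sqrt ((R 0 0)\<^sup>2 * (\<Sum>s\<in>tensor_index N d. (tt_row q U N s 0)\<^sup>2))"
    by (simp add: L2_set_def power_mult_distrib sum_distrib_left)
  also have "\<dots> = \<bar>R 0 0\<bar>"
    using nrm ann by auto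
  finally have "\<bar>R 0 0\<bar> = frob_norm N d X" by simp
  moreover have "frob_norm N d (\<lambda>s. tt_row q U N s 0) \<le> 1"
    using nrm by (auto simp: frob_norm_eq_L2_set L2_set_def)
  ultimately show ?thesis using that[of U "R 0 0"] U XU by (simp add: q_def)
qed

section \<open>Nets of tensor trains\<close>

text \<open>The mirror image of \<open>tt_row\<close>: the product of the last \<open>j\<close>
  cores as a column. The argument \<open>j\<close> counts from the right, so the column is indexed
  by \<open>{..<q (N - j)}\<close>.\<close>

primrec tt_col ::
  "(nat \<Rightarrow> nat) \<Rightarrow> (nat \<Rightarrow> nat \<Rightarrow> nat \<Rightarrow> nat \<Rightarrow> real) \<Rightarrow> nat \<Rightarrow> nat \<Rightarrow> multi_index \<Rightarrow> nat \<Rightarrow> real"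
where
  "tt_col q G N 0 s b = (if b = 0 then 1 else 0)"
| "tt_col q G N (Suc j) s a =
     (\<Sum>b<q (N - j). G (N - j) (s (N - j)) a b * tt_col q G N j s b)"

text \<open>The induction moves the cut in the chain one core to the left. The extreme cut
  \<open>j = N\<close> converts rows into columns, the form in which rounding errors are
  estimated.\<close>

lemma tt_row_tt_col:
  assumes "q N = 1" "j \<le> N"
  shows "(\<Sum>a<q (N - j). tt_row q G (N - j) s a * tt_col q G N j s a) = tt_row q G N s 0"
  using assms(2)
proof (induction j)
  case 0
  then show ?case using assms by simp
next
  case (Suc j)
  define n where "n = N - Suc j"
  have n: "N - j = Suc n" using Suc.prems by (simp add: n_def)
  have "(\<Sum>a<q n. tt_row q G n s a * tt_col q G N (Suc j) s a)
      = (\<Sum>a<q n. \<Sum>b<q (Suc n). tt_row q G n s a * G (Suc n) (s (Suc n)) a b * tt_col q G N j s b)"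
    by (simp add: n sum_distrib_left mult_ac)
  also have "\<dots> = (\<Sum>b<q (Suc n). tt_row q G (Suc n) s b * tt_col q G N j s b)"
    by (subst sum.swap) (simp add: sum_distrib_right)
  also have "\<dots> = tt_row q G N s 0"
    using Suc by (simp add: n del: tt_row.simps)
  finally show ?case by (simp add: n_def)
qed

lemma tt_col_cong:
  assumes "\<And>i. i \<in> {N - j<..N} \<Longrightarrow> G i = G' i \<and> s i = s' i" "j \<le> N"
  shows "tt_col q G N j s b = tt_col q G' N j s' b"
  using assms
proof (induction j arbitrary: b)
  case (Suc j)
  have "tt_col q G N j s a = tt_col q G' N j s' a" for a
    by (rule Suc.IH) (use Suc.prems in auto)
  moreover have "G (N - j) = G' (N - j)" "s (N - j) = s' (N - j)"
    using Suc.prems(1)[of "N - j"] Suc.prems(2) by auto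
  ultimately show ?case by simp
qed simp

text \<open>Greedy derandomised rounding: each coordinate is rounded up or down so that the new increment
  makes an obtuse angle with the error accumulated so far.\<close>

lemma greedy_rounding:
  fixes x :: "nat \<Rightarrow> real" and w :: "'s \<Rightarrow> nat \<Rightarrow> real"
  assumes h: "h > 0"
  shows "\<exists>z :: nat \<Rightarrow> int. (\<forall>b<n. \<bar>of_int (z b)\<bar> \<le> \<bar>x b\<bar> / h + 1) \<and>
    (\<Sum>\<sigma>\<in>S. (\<Sum>b<n. (h * of_int (z b) - x b) * w \<sigma> b)\<^sup>2) \<le> h\<^sup>2 * (\<Sum>\<sigma>\<in>S. \<Sum>b<n. (w \<sigma> b)\<^sup>2)"
proof (induction n)
  case (Suc n)
  then obtain z :: "nat \<Rightarrow> int" where z: "\<And>b. b < n \<Longrightarrow> \<bar>of_int (z b)\<bar> \<le> \<bar>x b\<bar> / h + 1"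
    and err: "(\<Sum>\<sigma>\<in>S. (\<Sum>b<n. (h * of_int (z b) - x b) * w \<sigma> b)\<^sup>2) \<le> h\<^sup>2 * (\<Sum>\<sigma>\<in>S. \<Sum>b<n. (w \<sigma> b)\<^sup>2)"
    by blast
  define P where "P \<sigma> = (\<Sum>b<n. (h * of_int (z b) - x b) * w \<sigma> b)" for \<sigma>
  \<comment> \<open>In the squared error, \<open>2 * \<delta> * t\<close> is the cross term of the
    new increment. Both neighbours of \<open>x n / h\<close> on the grid are kept available, so the
    sign of \<open>\<delta>\<close> can be opposed to that of \<open>t\<close>; only the quadratic
    term survives, and squared errors add. One \<open>z\<close> serves all \<open>\<sigma>\<close>
    because \<open>t\<close> sums over them.\<close>
  define t where "t = (\<Sum>\<sigma>\<in>S. P \<sigma> * w \<sigma> n)"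
  define f where "f = (if t \<ge> 0 then \<lfloor>x n / h\<rfloor> else \<lfloor>x n / h\<rfloor> + 1)"
  define \<delta> where "\<delta> = h * of_int f - x n"
  have fl: "of_int \<lfloor>x n / h\<rfloor> \<le> x n / h" "x n / h < of_int \<lfloor>x n / h\<rfloor> + 1"
    by linarith+
  have \<delta>: "\<delta> = h * (of_int f - x n / h)"
    using h by (simp add: \<delta>_def right_diff_distrib)
  have ab: "\<bar>of_int f - x n / h\<bar> \<le> 1"
  proof -
    have "of_int f = (of_int \<lfloor>x n / h\<rfloor> :: real) \<or> of_int f = (of_int \<lfloor>x n / h\<rfloor> + 1 :: real)"
      by (simp add: f_def)
    then show ?thesis using fl by linarith
  qed
  have "\<delta> * t \<le> 0"
  proof (cases "t \<ge> 0")
    case True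
    then have "\<delta> \<le> 0" using fl h by (simp add: \<delta> f_def mult_le_0_iff)
    then show ?thesis using True by (simp add: mult_le_0_iff)
  next
    case False
    then have "\<delta> \<ge> 0" using fl h by (simp add: \<delta> f_def)
    then show ?thesis using False by (simp add: mult_le_0_iff)
  qed
  moreover have "\<delta>\<^sup>2 \<le> h\<^sup>2"
    using ab by (simp add: \<delta> power_mult_distrib mult_left_le power2_le_iff_abs_le abs_square_le_1)
  ultimately have *: "(\<Sum>\<sigma>\<in>S. (P \<sigma> + \<delta> * w \<sigma> n)\<^sup>2) \<le> h\<^sup>2 * (\<Sum>\<sigma>\<in>S. \<Sum>b<Suc n. (w \<sigma> b)\<^sup>2)"
  proof -
    assume a: "\<delta> * t \<le> 0" "\<delta>\<^sup>2 \<le> h\<^sup>2"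
    have "(\<Sum>\<sigma>\<in>S. (P \<sigma> + \<delta> * w \<sigma> n)\<^sup>2)
        = (\<Sum>\<sigma>\<in>S. (P \<sigma>)\<^sup>2) + 2 * (\<delta> * t) + \<delta>\<^sup>2 * (\<Sum>\<sigma>\<in>S. (w \<sigma> n)\<^sup>2)"
      by (simp add: power2_sum power_mult_distrib sum.distrib t_def sum_distrib_left mult_ac)
    also have "\<dots> \<le> h\<^sup>2 * (\<Sum>\<sigma>\<in>S. \<Sum>b<n. (w \<sigma> b)\<^sup>2) + h\<^sup>2 * (\<Sum>\<sigma>\<in>S. (w \<sigma> n)\<^sup>2)"
      using err a mult_right_mono[OF a(2), of "\<Sum>\<sigma>\<in>S. (w \<sigma> n)\<^sup>2"]
      by (simp add: P_def sum_nonneg)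
    finally show ?thesis by (simp add: sum.distrib distrib_left)
  qed
  define z' where "z' = z(n := f)"
  have "\<bar>of_int (z' b)\<bar> \<le> \<bar>x b\<bar> / h + 1" if "b < Suc n" for b
  proof (cases "b = n")
    case True
    have "\<bar>of_int f\<bar> \<le> \<bar>x n / h\<bar> + (1::real)" using ab by linarith
    then show ?thesis using True h by (simp add: z'_def abs_divide)
  next
    case False
    then show ?thesis using z[of b] that by (simp add: z'_def)
  qed
  moreover have "(\<Sum>b<Suc n. (h * of_int (z' b) - x b) * w \<sigma> b) = P \<sigma> + \<delta> * w \<sigma> n" for \<sigma>
    by (simp add: P_def \<delta>_def z'_def)
  ultimately show ?case using * by (intro exI[of _ z']) auto
qed simp

lemma greedy_core_rounding:
  fixes X :: "nat \<Rightarrow> nat \<Rightarrow> nat \<Rightarrow> real" and w :: "'s \<Rightarrow> nat \<Rightarrow> real"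
  assumes h: "h > 0"
  obtains Z :: "nat \<Rightarrow> nat \<Rightarrow> nat \<Rightarrow> int" where
    "\<And>k a b. b < n \<Longrightarrow> \<bar>of_int (Z k a b)\<bar> \<le> \<bar>X k a b\<bar> / h + 1"
    "\<And>k a. (\<Sum>\<sigma>\<in>S. (\<Sum>b<n. (h * of_int (Z k a b) - X k a b) * w \<sigma> b)\<^sup>2)
       \<le> h\<^sup>2 * (\<Sum>\<sigma>\<in>S. \<Sum>b<n. (w \<sigma> b)\<^sup>2)"
proof -
  let ?P = "\<lambda>k a z. (\<forall>b<n. \<bar>of_int (z b)\<bar> \<le> \<bar>X k a b\<bar> / h + 1) \<and>
    (\<Sum>\<sigma>\<in>S. (\<Sum>b<n. (h * of_int (z b) - X k a b) * w \<sigma> b)\<^sup>2) \<le> h\<^sup>2 * (\<Sum>\<sigma>\<in>S. \<Sum>b<n. (w \<sigma> b)\<^sup>2)"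
  define Z where "Z k a = (SOME z. ?P k a z)" for k a
  have "?P k a (Z k a)" for k a
    unfolding Z_def by (rule someI_ex[where P = "?P k a"]) (rule greedy_rounding[OF h])
  then show ?thesis by (intro that[of Z]) auto
qed

lemma contractive_sum_le:
  assumes "contractive K p q X"
  shows "(\<Sum>k\<in>K. \<Sum>\<sigma>\<in>S. \<Sum>a<p. (\<Sum>b<q. X k a b * y \<sigma> b)\<^sup>2) \<le> (\<Sum>\<sigma>\<in>S. \<Sum>b<q. (y \<sigma> b)\<^sup>2)"
  by (subst sum.swap) (use assms in \<open>auto simp: contractive_def intro: sum_mono\<close>)

text \<open>Unit vectors as test vectors bound each column by 1. This Frobenius bound is what makes
  the rounded arrays small in the l1 norm.\<close>

lemma contractive_sum_entries_le:
  assumes "contractive K p q X"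
  shows "(\<Sum>k\<in>K. \<Sum>a<p. \<Sum>b<q. (X k a b)\<^sup>2) \<le> real q"
proof -
  have 1: "(\<Sum>k\<in>K. \<Sum>a<p. (X k a c)\<^sup>2) \<le> 1" if c: "c < q" for c
  proof -
    define v :: "nat \<Rightarrow> real" where "v b = (if b = c then 1 else 0)" for b
    have e: "(\<Sum>b<q. X k a b * v b) = X k a c" for k a
      using c by (simp add: v_def if_distrib cong: if_cong)
    have "(v b)\<^sup>2 = (if b = c then 1 else 0)" for b by (simp add: v_def)
    then have "(\<Sum>b<q. (v b)\<^sup>2) = 1" using c by simp
    then show ?thesis
      using assms[unfolded contractive_def, rule_format, of v] by (simp add: e)
  qed
  have "(\<Sum>k\<in>K. \<Sum>a<p. \<Sum>b<q. (X k a b)\<^sup>2) = (\<Sum>k\<in>K. \<Sum>b<q. \<Sum>a<p. (X k a b)\<^sup>2)"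
    by (intro sum.cong refl sum.swap)
  also have "\<dots> = (\<Sum>b<q. \<Sum>k\<in>K. \<Sum>a<p. (X k a b)\<^sup>2)"
    by (rule sum.swap)
  also have "\<dots> \<le> (\<Sum>b<q. 1)" by (intro sum_mono 1) simp
  finally show ?thesis by simp
qed

text \<open>The cores are rounded from the last to the first, because the error made in one core is measured
  against the already rounded chain to its right.\<close>

lemma chain_rounding:
  fixes U :: "nat \<Rightarrow> nat \<Rightarrow> nat \<Rightarrow> nat \<Rightarrow> real"
  assumes contr: "\<forall>i\<in>{1..N}. contractive {1..d i} (q (i - 1)) (q i) (U i)"
    and h: "h > 0" and \<eta>: "\<eta> \<ge> 0"
    and h\<eta>: "\<forall>i\<in>{1..N}. h\<^sup>2 * (real (d i) * real (q (i - 1))) \<le> \<eta>\<^sup>2"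
    and qN: "q N = 1"
  defines "T \<equiv> \<lambda>j. PiE {N - j<..N} (\<lambda>i. {1..d i}) \<times> {..<q (N - j)}"
  defines "G \<equiv> \<lambda>Z i k a b. h * of_int (Z i k a b :: int)"
  assumes "j \<le> N"
  shows "\<exists>Z. (\<forall>i\<in>{N - j<..N}. \<forall>k a b. b < q i \<longrightarrow> \<bar>of_int (Z i k a b)\<bar> \<le> \<bar>U i k a b\<bar> / h + 1) \<and>
     L2_set (\<lambda>(s, a). tt_col q (G Z) N j s a) (T j) \<le> (1 + \<eta>) ^ j \<and>
     L2_set (\<lambda>(s, a). tt_col q (G Z) N j s a - tt_col q U N j s a) (T j) \<le> (1 + \<eta>) ^ j - 1"
  using \<open>j \<le> N\<close>
proof (induction j)
  case 0
  have T0: "T 0 = {(\<lambda>_. undefined, 0)}" by (auto simp: T_def qN)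
  show ?case by (rule exI[of _ "\<lambda>_ _ _ _. 0"]) (simp add: T0)
next
  case (Suc j)
  obtain Z where
    Zb: "\<And>i k a b. i \<in> {N - j<..N} \<Longrightarrow> b < q i \<Longrightarrow> \<bar>of_int (Z i k a b)\<bar> \<le> \<bar>U i k a b\<bar> / h + 1"
    and Zn: "L2_set (\<lambda>(s, a). tt_col q (G Z) N j s a) (T j) \<le> (1 + \<eta>) ^ j"
    and Ze: "L2_set (\<lambda>(s, a). tt_col q (G Z) N j s a - tt_col q U N j s a) (T j) \<le> (1 + \<eta>) ^ j - 1"
    using Suc.IH[OF Suc_leD[OF Suc.prems]]
  proof (elim exE conjE, goal_cases)
    case (1 Z)
    show ?case by (rule 1(1)[of Z]) (use 1(2-4) in blast)+
  qed
  define n where "n = N - j"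
  have nN: "n \<in> {1..N}" and n1: "N - Suc j = n - 1" using Suc.prems by (auto simp: n_def)
  define S where "S = PiE {n<..N} (\<lambda>i. {1..d i})"
  define w where "w s b = tt_col q (G Z) N j s b" for s b
  define v where "v s b = tt_col q U N j s b" for s b
  define X where "X = U n"
  obtain Zc :: "nat \<Rightarrow> nat \<Rightarrow> nat \<Rightarrow> int" where
    Zcb: "\<And>k a b. b < q n \<Longrightarrow> \<bar>of_int (Zc k a b)\<bar> \<le> \<bar>X k a b\<bar> / h + 1"
    and Zce: "\<And>k a. (\<Sum>\<sigma>\<in>S. (\<Sum>b<q n. (h * of_int (Zc k a b) - X k a b) * w \<sigma> b)\<^sup>2)
       \<le> h\<^sup>2 * (\<Sum>\<sigma>\<in>S. \<Sum>b<q n. (w \<sigma> b)\<^sup>2)"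
    by (rule greedy_core_rounding[OF h, where X = X and w = w and n = "q n" and S = S]) blast
  define Z' where "Z' = Z(n := Zc)"
  have Sn: "{N - Suc j<..N} = insert n {n<..N}" using Suc.prems by (auto simp: n_def)
  have TSuc: "T (Suc j) = PiE (insert n {n<..N}) (\<lambda>i. {1..d i}) \<times> {..<q (n - 1)}"
    unfolding T_def n1[symmetric] Sn[symmetric] by (rule refl)
  have L2T: "L2_set F (T (Suc j)) = sqrt (\<Sum>k\<in>{1..d n}. \<Sum>\<sigma>\<in>S. \<Sum>a<q (n - 1). (F (\<sigma>(n := k), a))\<^sup>2)" for F
  proof -
    have "(\<Sum>y\<in>T (Suc j). (F y)\<^sup>2) = (\<Sum>s\<in>PiE (insert n {n<..N}) (\<lambda>i. {1..d i}). \<Sum>a<q (n - 1). (F (s, a))\<^sup>2)"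
      by (simp add: TSuc sum.cartesian_product)
    also have "\<dots> = (\<Sum>k\<in>{1..d n}. \<Sum>\<sigma>\<in>S. \<Sum>a<q (n - 1). (F (\<sigma>(n := k), a))\<^sup>2)"
      by (subst sum_PiE_insert) (simp_all add: S_def)
    finally show ?thesis by (simp add: L2_set_def)
  qed
  have L2j: "L2_set (\<lambda>(s, a). f s a) (T j) = sqrt (\<Sum>\<sigma>\<in>S. \<Sum>b<q n. (f \<sigma> b)\<^sup>2)" for f
    by (simp add: L2_set_def T_def S_def n_def[symmetric] sum.cartesian_product case_prod_beta)
  have w_upd: "w (\<sigma>(n := k)) b = w \<sigma> b" "v (\<sigma>(n := k)) b = v \<sigma> b" for \<sigma> k b
    unfolding w_def v_def using Suc.prems by (auto intro!: tt_col_cong simp: n_def)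
  have colZ': "tt_col q (G Z') N j s b = w s b" for s b
    unfolding w_def using Suc.prems by (auto intro!: tt_col_cong simp: n_def Z'_def G_def)
  \<comment> \<open>Exchanging core \<open>n\<close>: \<open>P\<close> is the exact core on the
    rounded tail, \<open>M\<close> the exact core on the error of the tail, \<open>E\<close> the
    rounding error of the core on the rounded tail. Contractivity of the exact core keeps
    \<open>P\<close> and \<open>M\<close> from growing; only \<open>E\<close> costs a
    factor.\<close>
  define E where "E = (\<lambda>(s, a). \<Sum>b<q n. (h * of_int (Zc (s n) a b) - X (s n) a b) * w s b)"
  define P where "P = (\<lambda>(s, a). \<Sum>b<q n. X (s n) a b * w s b)"
  define M where "M = (\<lambda>(s, a). \<Sum>b<q n. X (s n) a b * (w s b - v s b))"
  have c1: "tt_col q (G Z') N (Suc j) s a = P (s, a) + E (s, a)" for s a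
    using colZ' by (simp add: n_def[symmetric] P_def E_def sum.distrib[symmetric] G_def Z'_def algebra_simps)
  have "tt_col q U N (Suc j) s a = (\<Sum>b<q n. X (s n) a b * v s b)" for s a
    by (simp add: n_def[symmetric] X_def v_def)
  then have c2: "tt_col q (G Z') N (Suc j) s a - tt_col q U N (Suc j) s a = M (s, a) + E (s, a)" for s a
    unfolding c1 by (simp add: P_def M_def right_diff_distrib sum_subtractf)
  \<comment> \<open>Each of the \<open>d n * q (n - 1)\<close> rows has squared error at most
    \<open>h\<^sup>2\<close> times the squared norm of the tail, and the mesh is such that together
    they give \<open>\<eta>\<^sup>2\<close>.\<close>
  have LE: "L2_set E (T (Suc j)) \<le> \<eta> * L2_set (\<lambda>(s, a). tt_col q (G Z) N j s a) (T j)"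
  proof -
    define W where "W = (\<Sum>\<sigma>\<in>S. \<Sum>b<q n. (w \<sigma> b)\<^sup>2)"
    have "(\<Sum>k\<in>{1..d n}. \<Sum>\<sigma>\<in>S. \<Sum>a<q (n - 1). (E (\<sigma>(n := k), a))\<^sup>2)
        = (\<Sum>k\<in>{1..d n}. \<Sum>a<q (n - 1). \<Sum>\<sigma>\<in>S. (\<Sum>b<q n. (h * of_int (Zc k a b) - X k a b) * w \<sigma> b)\<^sup>2)"
      by (intro sum.cong refl, subst sum.swap) (simp add: E_def w_upd)
    also have "\<dots> \<le> (\<Sum>k\<in>{1..d n}. \<Sum>a<q (n - 1). h\<^sup>2 * W)"
      unfolding W_def by (intro sum_mono Zce)
    also have "\<dots> = h\<^sup>2 * (real (d n) * real (q (n - 1))) * W" by simp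
    also have "\<dots> \<le> \<eta>\<^sup>2 * W"
      by (intro mult_right_mono bspec[OF h\<eta> nN]) (simp add: W_def sum_nonneg)
    finally have "L2_set E (T (Suc j)) \<le> sqrt (\<eta>\<^sup>2 * W)" unfolding L2T by simp
    also have "\<dots> = \<eta> * L2_set (\<lambda>(s, a). tt_col q (G Z) N j s a) (T j)"
      using \<eta> by (simp add: L2j real_sqrt_mult W_def w_def)
    finally show ?thesis .
  qed
  have LP: "L2_set P (T (Suc j)) \<le> L2_set (\<lambda>(s, a). tt_col q (G Z) N j s a) (T j)"
    unfolding L2T L2j
    using contractive_sum_le[OF bspec[OF contr nN], where S = S and y = w] by (simp add: P_def w_upd X_def w_def[symmetric])
  have LM: "L2_set M (T (Suc j)) \<le> L2_set (\<lambda>(s, a). tt_col q (G Z) N j s a - tt_col q U N j s a) (T j)"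
    unfolding L2T L2j
    using contractive_sum_le[OF bspec[OF contr nN], where S = S and y = "\<lambda>s b. w s b - v s b"]
    by (simp add: M_def w_upd X_def w_def[symmetric] v_def[symmetric])
  have LE': "L2_set E (T (Suc j)) \<le> \<eta> * (1 + \<eta>) ^ j"
    using LE mult_left_mono[OF Zn \<eta>] by linarith
  have "L2_set (\<lambda>(s, a). tt_col q (G Z') N (Suc j) s a) (T (Suc j)) \<le> (1 + \<eta>) ^ Suc j"
  proof -
    have "L2_set (\<lambda>(s, a). tt_col q (G Z') N (Suc j) s a) (T (Suc j)) = L2_set (\<lambda>y. P y + E y) (T (Suc j))"
      by (intro L2_set_cong) (auto simp: c1 simp del: tt_col.simps)
    also have "\<dots> \<le> L2_set P (T (Suc j)) + L2_set E (T (Suc j))"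
      by (rule L2_set_triangle_ineq)
    also have "\<dots> \<le> (1 + \<eta>) ^ j + \<eta> * (1 + \<eta>) ^ j"
      using LP LE' Zn by linarith
    finally show ?thesis by (simp add: algebra_simps)
  qed
  moreover have "L2_set (\<lambda>(s, a). tt_col q (G Z') N (Suc j) s a - tt_col q U N (Suc j) s a) (T (Suc j))
      \<le> (1 + \<eta>) ^ Suc j - 1"
  proof -
    have "L2_set (\<lambda>(s, a). tt_col q (G Z') N (Suc j) s a - tt_col q U N (Suc j) s a) (T (Suc j))
        = L2_set (\<lambda>y. M y + E y) (T (Suc j))"
      by (intro L2_set_cong) (auto simp: c2 simp del: tt_col.simps)
    also have "\<dots> \<le> L2_set M (T (Suc j)) + L2_set E (T (Suc j))"
      by (rule L2_set_triangle_ineq)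
    also have "\<dots> \<le> ((1 + \<eta>) ^ j - 1) + \<eta> * (1 + \<eta>) ^ j"
      using LM LE' Ze by linarith
    finally show ?thesis by (simp add: algebra_simps)
  qed
  moreover have "\<bar>of_int (Z' i k a b)\<bar> \<le> \<bar>U i k a b\<bar> / h + 1"
    if "i \<in> {N - Suc j<..N}" "b < q i" for i k a b
  proof (cases "i = n")
    case True
    then show ?thesis using Zcb[of b k a] that by (simp add: Z'_def X_def)
  next
    case False
    then show ?thesis using Zb[of i b k a] that unfolding Sn by (simp add: Z'_def n_def)
  qed
  ultimately show ?case by (intro exI[of _ Z']) blast
qed

section \<open>Counting integer points of an l1 ball\<close>

lemma sum_exp_neg_abs_le:
  fixes l :: real
  assumes "0 < l" "l \<le> 1"
  shows "(\<Sum>z\<in>{-L..L}. exp (- l * \<bar>of_int z\<bar>)) \<le> 4 / l"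
proof -
  define x where "x = exp (- l)"
  have x: "0 < x" "x < 1" using assms by (simp_all add: x_def)
  have "x \<le> 1 / (1 + l)"
    using exp_ge_add_one_self[of l] assms by (simp add: x_def exp_minus field_simps)
  then have "1 - x \<ge> 1 - 1 / (1 + l)" by simp
  moreover have "1 - 1 / (1 + l) \<ge> l / 2"
    using assms by (simp add: field_simps)
  ultimately have x1: "1 - x \<ge> l / 2" by linarith
  have e: "exp (- l * real k) = x ^ k" for k
    by (simp add: x_def exp_of_nat_mult[symmetric] mult.commute)
  have geo: "(\<Sum>k\<le>n. x ^ k) \<le> 1 / (1 - x)" for n
    using sum_le_suminf[of "\<lambda>k. x ^ k" "{..n}"] x suminf_geometric[of x] by (simp add: summable_geometric)
  \<comment> \<open>Two geometric series with ratio \<open>x\<close>; \<open>z = 0\<close> is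
    covered twice, which only weakens the bound.\<close>
  have "{-L..L} \<subseteq> int ` {..nat L} \<union> (\<lambda>k. - int k) ` {..nat L}"
  proof
    fix z assume "z \<in> {-L..L}"
    then have "z = int (nat z) \<and> nat z \<in> {..nat L} \<or> z = - int (nat (- z)) \<and> nat (- z) \<in> {..nat L}"
      by auto
    then show "z \<in> int ` {..nat L} \<union> (\<lambda>k. - int k) ` {..nat L}"
      by (metis UnI1 UnI2 image_eqI)
  qed
  then have "(\<Sum>z\<in>{-L..L}. exp (- l * \<bar>of_int z\<bar>))
      \<le> (\<Sum>z\<in>int ` {..nat L} \<union> (\<lambda>k. - int k) ` {..nat L}. exp (- l * \<bar>of_int z\<bar>))"
    by (intro sum_mono2) auto
  also have "\<dots> \<le> (\<Sum>z\<in>int ` {..nat L}. exp (- l * \<bar>of_int z\<bar>))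
      + (\<Sum>z\<in>(\<lambda>k. - int k) ` {..nat L}. exp (- l * \<bar>of_int z\<bar>))"
    by (simp add: sum_Un sum_nonneg)
  also have "\<dots> = (\<Sum>k\<le>nat L. x ^ k) + (\<Sum>k\<le>nat L. x ^ k)"
    using e by (subst (1 2) sum.reindex) (auto simp: inj_on_def)
  also have "\<dots> \<le> 2 * (1 / (1 - x))" using geo[of "nat L"] by simp
  also have "\<dots> \<le> 2 * (1 / (l / 2))"
    using x1 assms by (intro mult_left_mono divide_left_mono) auto
  finally show ?thesis by simp
qed

text \<open>A Chernoff bound for the counting measure: on the ball the weight
  \<open>exp (l * (M - sum))\<close> is at least 1, and the sum of all weights factorises over the
  coordinates. For \<open>M\<close> of order \<open>card E / l\<close> the result is a constant
  multiple of \<open>1 / l\<close> per coordinate.\<close>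

lemma card_integer_l1_ball:
  fixes l M :: real
  assumes fin: "finite E" and l: "0 < l" "l \<le> 1"
  defines "B \<equiv> {\<zeta> \<in> PiE E (\<lambda>_. UNIV :: int set). (\<Sum>e\<in>E. \<bar>of_int (\<zeta> e)\<bar>) \<le> M}"
  shows "finite B" "real (card B) \<le> exp (l * M) * (4 / l) ^ card E"
proof -
  \<comment> \<open>A cut-off that makes the product set finite; the final bound does not depend on
    it.\<close>
  define L where "L = \<lfloor>M\<rfloor>"
  have sub: "B \<subseteq> PiE E (\<lambda>_. {-L..L})"
  proof
    fix \<zeta> assume \<zeta>: "\<zeta> \<in> B"
    have "\<zeta> e \<in> {-L..L}" if "e \<in> E" for e
    proof -
      have "\<bar>real_of_int (\<zeta> e)\<bar> \<le> (\<Sum>e\<in>E. \<bar>of_int (\<zeta> e)\<bar>)"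
        using that fin by (intro member_le_sum) auto
      then have "real_of_int \<bar>\<zeta> e\<bar> \<le> M" using \<zeta> by (simp add: B_def)
      then have "\<bar>\<zeta> e\<bar> \<le> L" by (simp add: L_def le_floor_iff)
      then show ?thesis by auto
    qed
    then show "\<zeta> \<in> PiE E (\<lambda>_. {-L..L})" using \<zeta> by (auto simp: B_def PiE_def)
  qed
  have finP: "finite (PiE E (\<lambda>_. {-L..L}))" using fin by (intro finite_PiE) auto
  show "finite B" using sub finP by (rule finite_subset)
  have "real (card B) = (\<Sum>\<zeta>\<in>B. 1)" by simp
  also have "\<dots> \<le> (\<Sum>\<zeta>\<in>B. exp (l * M) * (\<Prod>e\<in>E. exp (- l * \<bar>of_int (\<zeta> e)\<bar>)))"
  proof (rule sum_mono)
    fix \<zeta> assume "\<zeta> \<in> B"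
    then have "0 \<le> l * (M - (\<Sum>e\<in>E. \<bar>of_int (\<zeta> e)\<bar>))" using l by (simp add: B_def)
    then have "1 \<le> exp (l * (M - (\<Sum>e\<in>E. \<bar>of_int (\<zeta> e)\<bar>)))" by simp
    also have "\<dots> = exp (l * M + (\<Sum>e\<in>E. - l * \<bar>of_int (\<zeta> e)\<bar>))"
      by (simp add: right_diff_distrib sum_distrib_left sum_negf)
    also have "\<dots> = exp (l * M) * (\<Prod>e\<in>E. exp (- l * \<bar>of_int (\<zeta> e)\<bar>))"
      using fin by (simp add: exp_add exp_sum)
    finally show "1 \<le> exp (l * M) * (\<Prod>e\<in>E. exp (- l * \<bar>of_int (\<zeta> e)\<bar>))" .
  qed
  also have "\<dots> \<le> (\<Sum>\<zeta>\<in>PiE E (\<lambda>_. {-L..L}). exp (l * M) * (\<Prod>e\<in>E. exp (- l * \<bar>of_int (\<zeta> e)\<bar>)))"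
    using finP sub by (intro sum_mono2) (auto intro!: mult_nonneg_nonneg prod_nonneg)
  also have "\<dots> = exp (l * M) * (\<Prod>e\<in>E. \<Sum>z\<in>{-L..L}. exp (- l * \<bar>of_int z\<bar>))"
    using fin by (subst prod_sum_PiE) (auto simp: sum_distrib_left)
  also have "\<dots> \<le> exp (l * M) * (\<Prod>e\<in>E. 4 / l)"
    using sum_exp_neg_abs_le[OF l, of L] by (intro mult_left_mono prod_mono) (auto intro: sum_nonneg)
  finally show "real (card B) \<le> exp (l * M) * (4 / l) ^ card E" by simp
qed

text \<open>The net takes one tensor for every integer array in the l1 ball, whether or not the
  array arises by rounding a contractive chain; enlarging the set this way makes it countable by
  \<open>card_integer_l1_ball\<close>.\<close>

lemma tt_net:
  fixes \<epsilon> :: real and N D r :: nat and d q :: "nat \<Rightarrow> nat"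
  assumes N: "N \<ge> 1" and dD: "\<And>i. i \<in> {1..N} \<Longrightarrow> d i \<le> D" and D: "D \<ge> 1"
    and qr: "\<And>i. i \<le> N \<Longrightarrow> q i \<le> r" and q0: "q 0 = 1" and qN: "q N = 1"
    and \<epsilon>: "0 < \<epsilon>" "\<epsilon> \<le> 1"
  obtains S :: "tensor set" where
    "finite S" "real (card S) \<le> (128 * real N / \<epsilon>) ^ (N * D * r\<^sup>2)"
    "\<And>U. \<forall>i\<in>{1..N}. contractive {1..d i} (q (i - 1)) (q i) (U i) \<Longrightarrow>
       \<exists>Y\<in>S. frob_norm N d (\<lambda>s. tt_row q U N s 0 - Y s) \<le> \<epsilon>"
proof -
  have r: "r \<ge> 1" using qr[of 0] q0 by simp
  \<comment> \<open>Error per core: \<open>(1 + \<eta>) ^ N - 1 \<le> exp (\<epsilon> / 2) - 1 \<le>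
    \<epsilon>\<close>.\<close>
  define \<eta> where "\<eta> = \<epsilon> / (2 * real N)"
  \<comment> \<open>A core has at most \<open>D * r\<close> rows, and
    \<open>h\<^sup>2 * (D * r) = \<eta>\<^sup>2\<close>.\<close>
  define h where "h = \<eta> / sqrt (real D * real r)"
  define Q where "Q = N * D * r\<^sup>2"
  have \<eta>: "0 < \<eta>" "\<eta> \<le> 1" using \<epsilon> N by (simp_all add: \<eta>_def field_simps)
  have Dr: "real D * real r > 0" using D r by simp
  have h: "h > 0" using \<eta> Dr by (simp add: h_def)
  have h2: "h\<^sup>2 = \<eta>\<^sup>2 / (real D * real r)" using D r by (simp add: h_def power_divide)
  have h\<eta>: "\<forall>i\<in>{1..N}. h\<^sup>2 * (real (d i) * real (q (i - 1))) \<le> \<eta>\<^sup>2"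
  proof
    fix i assume i: "i \<in> {1..N}"
    have "real (d i) * real (q (i - 1)) \<le> real D * real r"
      using dD[OF i] qr[of "i - 1"] i by (intro mult_mono) auto
    then have "h\<^sup>2 * (real (d i) * real (q (i - 1))) \<le> h\<^sup>2 * (real D * real r)"
      by (rule mult_left_mono) simp
    also have "\<dots> = \<eta>\<^sup>2" using D r by (simp add: h2)
    finally show "h\<^sup>2 * (real (d i) * real (q (i - 1))) \<le> \<eta>\<^sup>2" .
  qed
  define E where "E = (SIGMA i:{1..N}. {1..d i} \<times> {..<q (i - 1)} \<times> {..<q i})"
  have finE: "finite E" by (simp add: E_def)
  have "card E = (\<Sum>i\<in>{1..N}. d i * (q (i - 1) * q i))"
    by (simp add: E_def card_SigmaI card_cartesian_product)
  also have "\<dots> \<le> (\<Sum>i\<in>{1..N}. D * (r * r))"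
    using dD qr by (intro sum_mono mult_mono) auto
  finally have cE: "card E \<le> Q" by (simp add: Q_def power2_eq_square mult_ac)
  \<comment> \<open>Dividing the entries by \<open>h\<close> contributes at most
    \<open>Q / \<eta>\<close> to the l1 norm, and rounding at most 1 for each of at most
    \<open>Q\<close> entries; since \<open>\<eta> \<le> 1\<close>, the total is at most
    \<open>2 * Q / \<eta>\<close>.\<close>
  define M where "M = 2 * real Q / \<eta>"
  define B where "B = {\<zeta> \<in> PiE E (\<lambda>_. UNIV :: int set). (\<Sum>e\<in>E. \<bar>of_int (\<zeta> e)\<bar>) \<le> M}"
  define tens where "tens \<zeta> = (\<lambda>s. tt_row q (\<lambda>i k a b. h * of_int (\<zeta> (i, k, a, b) :: int)) N s 0)" for \<zeta>
  define S where "S = tens ` B"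
  \<comment> \<open>The weight parameter is \<open>l = \<eta>\<close>, so that
    \<open>exp (\<eta> * M) = exp 2 ^ Q\<close> costs only a constant per entry.\<close>
  have finB: "finite B" and cB: "real (card B) \<le> exp (\<eta> * M) * (4 / \<eta>) ^ card E"
    using card_integer_l1_ball[OF finE \<eta>, of M] by (simp_all add: B_def)
  have "real (card S) \<le> real (card B)"
    using finB by (simp add: S_def card_image_le)
  also have "\<dots> \<le> exp (\<eta> * M) * (4 / \<eta>) ^ card E" by (rule cB)
  also have "\<dots> \<le> exp (\<eta> * M) * (4 / \<eta>) ^ Q"
    using \<eta> cE by (intro mult_left_mono power_increasing) auto
  also have "\<dots> = (exp 2 * (4 / \<eta>)) ^ Q"
  proof -
    have "\<eta> * M = real Q * 2" using \<eta> by (simp add: M_def)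
    then show ?thesis by (simp only: exp_of_nat_mult power_mult_distrib)
  qed
  also have "\<dots> \<le> (128 * real N / \<epsilon>) ^ Q"
  proof (rule power_mono)
    \<comment> \<open>Origin of 128: 16 bounds \<open>exp 2\<close>, and \<open>4 / \<eta>\<close>
      is \<open>8 * N / \<epsilon>\<close>.\<close>
    have "exp (2::real) = exp 1 * exp 1" by (simp add: exp_add[symmetric])
    also have "\<dots> \<le> 3 * (3::real)" by (intro mult_mono exp_le) auto
    finally have "exp (2::real) \<le> 16" by simp
    then have "exp 2 * (4 / \<eta>) \<le> 16 * (4 / \<eta>)" using \<eta> by (intro mult_right_mono) auto
    also have "\<dots> = 128 * real N / \<epsilon>" by (simp add: \<eta>_def)
    finally show "exp 2 * (4 / \<eta>) \<le> 128 * real N / \<epsilon>" .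
  qed (use \<eta> in simp)
  finally have cS: "real (card S) \<le> (128 * real N / \<epsilon>) ^ (N * D * r\<^sup>2)" by (simp add: Q_def)
  have "\<exists>Y\<in>S. frob_norm N d (\<lambda>s. tt_row q U N s 0 - Y s) \<le> \<epsilon>"
    if U: "\<forall>i\<in>{1..N}. contractive {1..d i} (q (i - 1)) (q i) (U i)" for U
  proof -
    obtain Z :: "nat \<Rightarrow> nat \<Rightarrow> nat \<Rightarrow> nat \<Rightarrow> int" where
      Zb: "\<And>i k a b. i \<in> {1..N} \<Longrightarrow> b < q i \<Longrightarrow> \<bar>of_int (Z i k a b)\<bar> \<le> \<bar>U i k a b\<bar> / h + 1"
      and Ze: "L2_set (\<lambda>(s, a). tt_col q (\<lambda>i k a b. h * of_int (Z i k a b)) N N s a - tt_col q U N N s a)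
         (PiE {N - N<..N} (\<lambda>i. {1..d i}) \<times> {..<q (N - N)}) \<le> (1 + \<eta>) ^ N - 1"
      using chain_rounding[where N = N and d = d and q = q and U = U and h = h and \<eta> = \<eta> and j = N,
          OF U h less_imp_le[OF \<eta>(1)] h\<eta> qN order_refl]
    proof (elim exE conjE, goal_cases)
      case (1 Z)
      show ?case
      proof (rule 1(1)[of Z])
        show "\<bar>of_int (Z i k a b)\<bar> \<le> \<bar>U i k a b\<bar> / h + 1" if "i \<in> {1..N}" "b < q i" for i k a b
          using 1(2) that by auto
      qed (fact 1(4))
    qed
    define \<zeta> where "\<zeta> = restrict (\<lambda>(i, k, a, b). Z i k a b) E"
    have sumE: "(\<Sum>e\<in>E. (case e of (i, k, a, b) \<Rightarrow> (U i k a b)\<^sup>2)) \<le> real N * real r"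
    proof -
      have "(\<Sum>e\<in>E. (case e of (i, k, a, b) \<Rightarrow> (U i k a b)\<^sup>2))
          = (\<Sum>i\<in>{1..N}. \<Sum>k\<in>{1..d i}. \<Sum>a<q (i - 1). \<Sum>b<q i. (U i k a b)\<^sup>2)"
        unfolding E_def by (subst sum.Sigma[symmetric]) (simp_all add: sum.cartesian_product)
      also have "\<dots> \<le> (\<Sum>i\<in>{1..N}. real (q i))"
        by (intro sum_mono contractive_sum_entries_le bspec[OF U])
      also have "\<dots> \<le> (\<Sum>i\<in>{1..N}. real r)"
        using qr by (intro sum_mono) auto
      finally show ?thesis by simp
    qed
    \<comment> \<open>Cauchy-Schwarz turns the total Frobenius bound \<open>N * r\<close> into an l1
      bound. After division by \<open>h\<close> the expression under the root is
      \<open>(N * r) * Q * (D * r) = Q\<^sup>2\<close>, so dimensions and ranks enter through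
      \<open>Q\<close> alone.\<close>
    have "(\<Sum>e\<in>E. (case e of (i, k, a, b) \<Rightarrow> \<bar>U i k a b\<bar>))
        = (\<Sum>e\<in>E. \<bar>case e of (i, k, a, b) \<Rightarrow> U i k a b\<bar> * \<bar>1\<bar>)"
      by (simp add: case_prod_beta)
    also have "\<dots> \<le> L2_set (\<lambda>(i, k, a, b). U i k a b) E * L2_set (\<lambda>_. 1) E"
      by (rule L2_set_mult_ineq)
    also have "\<dots> = sqrt (\<Sum>e\<in>E. (case e of (i, k, a, b) \<Rightarrow> (U i k a b)\<^sup>2)) * sqrt (card E)"
      by (simp add: L2_set_def case_prod_beta)
    also have "\<dots> \<le> sqrt (real N * real r) * sqrt (real Q)"
      using sumE cE by (intro mult_mono real_sqrt_le_mono) (auto intro!: sum_nonneg)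
    finally have U1: "(\<Sum>e\<in>E. (case e of (i, k, a, b) \<Rightarrow> \<bar>U i k a b\<bar>)) \<le> sqrt (real N * real r) * sqrt (real Q)" .
    have "(\<Sum>e\<in>E. \<bar>real_of_int (\<zeta> e)\<bar>) \<le> (\<Sum>e\<in>E. (case e of (i, k, a, b) \<Rightarrow> \<bar>U i k a b\<bar>) / h + 1)"
      using Zb by (intro sum_mono) (auto simp: \<zeta>_def E_def)
    also have "\<dots> = (\<Sum>e\<in>E. (case e of (i, k, a, b) \<Rightarrow> \<bar>U i k a b\<bar>)) / h + real (card E)"
      by (simp add: sum.distrib sum_divide_distrib)
    also have "\<dots> \<le> sqrt (real N * real r) * sqrt (real Q) / h + real Q"
      using U1 h cE by (intro add_mono divide_right_mono) auto
    also have "sqrt (real N * real r) * sqrt (real Q) / h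
        = sqrt ((real N * real r) * real Q * (real D * real r)) / \<eta>"
      by (simp add: h_def real_sqrt_mult)
    also have "(real N * real r) * real Q * (real D * real r) = (real Q)\<^sup>2"
      by (simp add: Q_def power2_eq_square)
    also have "sqrt ((real Q)\<^sup>2) / \<eta> + real Q \<le> M"
      using \<eta> mult_right_mono[of \<eta> 1 "real Q"] by (simp add: M_def field_simps)
    finally have "\<zeta> \<in> B" by (simp add: B_def \<zeta>_def)
    moreover have "frob_norm N d (\<lambda>s. tt_row q U N s 0 - tens \<zeta> s) \<le> \<epsilon>"
    proof -
      let ?G = "\<lambda>i k a b. h * of_int (Z i k a b)"
      have row_col: "tt_row q G N s 0 = tt_col q G N N s 0" for G s
        using tt_row_tt_col[where q = q and N = N and j = N and G = G and s = s, OF qN order_refl] q0 by simp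
      have tz: "tens \<zeta> s = tt_col q ?G N N s 0" if "s \<in> tensor_index N d" for s
        unfolding row_col[symmetric] tens_def
        by (rule tt_row_cong) (use that qN in \<open>auto simp: \<zeta>_def E_def tensor_index_def PiE_def Pi_def\<close>)
      have IN: "{N - N<..N} = {1..N}" by auto
      have "frob_norm N d (\<lambda>s. tt_row q U N s 0 - tens \<zeta> s)
          = sqrt (\<Sum>s\<in>tensor_index N d. (tt_col q ?G N N s 0 - tt_col q U N N s 0)\<^sup>2)"
        unfolding frob_norm_eq_L2_set L2_set_def
        by (intro arg_cong[where f = sqrt] sum.cong refl) (simp add: tz row_col power2_commute)
      also have "\<dots> = L2_set (\<lambda>(s, a). tt_col q ?G N N s a - tt_col q U N N s a)
          (PiE {N - N<..N} (\<lambda>i. {1..d i}) \<times> {..<q (N - N)})"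
        unfolding IN L2_set_def tensor_index_def
        by (simp add: sum.cartesian_product' q0 del: tt_col.simps)
      also have "\<dots> \<le> (1 + \<eta>) ^ N - 1" by (rule Ze)
      also have "\<dots> \<le> exp \<eta> ^ N - 1"
        using \<eta> exp_ge_add_one_self[of \<eta>] by (simp add: power_mono)
      also have "exp \<eta> ^ N = exp (\<epsilon> / 2)"
        using N by (simp add: exp_of_nat_mult[symmetric] \<eta>_def)
      also have "exp (\<epsilon> / 2) - 1 \<le> \<epsilon> / 2 + (\<epsilon> / 2)\<^sup>2"
        using exp_bound[of "\<epsilon> / 2"] \<epsilon> by simp
      also have "\<dots> \<le> \<epsilon>"
      proof -
        have "\<epsilon> * \<epsilon> \<le> \<epsilon> * 1" using \<epsilon> by (intro mult_left_mono) auto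
        moreover have "(\<epsilon> / 2)\<^sup>2 = \<epsilon> * \<epsilon> / 4" by (simp add: power2_eq_square)
        ultimately show ?thesis using \<epsilon> by linarith
      qed
      finally show ?thesis .
    qed
    ultimately show ?thesis unfolding S_def by blast
  qed
  then show ?thesis using that[of S] cS finB by (simp add: S_def)
qed

text \<open>For each \<open>n\<close> the grid of width \<open>1 / (n + 1)\<close> has countably
  many cells, labelled by integer tuples; one member of \<open>S\<close> is kept from every cell
  that meets \<open>S\<close>. The approximants thus lie in \<open>S\<close> itself, whatever
  \<open>S\<close> is.\<close>

lemma countable_dense_functions:
  fixes S :: "('i \<Rightarrow> real) set"
  assumes I: "finite I"
  obtains C where "C \<subseteq> S" "countable C"
    "\<And>x. x \<in> S \<Longrightarrow> \<exists>y. (\<forall>n::nat. y n \<in> C) \<and> (\<forall>i\<in>I. (\<lambda>n. y n i) \<longlonglongrightarrow> x i)"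
proof -
  define g where "g n x = (\<lambda>i\<in>I. \<lfloor>x i * real (Suc n)\<rfloor>)" for n :: nat and x :: "'i \<Rightarrow> real"
  define p where "p n x = inv_into S (g n) (g n x)" for n x
  have "countable (g n ` S)" for n
  proof (rule countable_subset)
    show "g n ` S \<subseteq> PiE I (\<lambda>_. UNIV)" by (auto simp: g_def)
    show "countable (PiE I (\<lambda>_. UNIV :: int set))" by (intro countable_PiE I) auto
  qed
  then have cnt: "countable (p n ` S)" for n
    unfolding p_def image_image[symmetric, of "inv_into S (g n)" "g n"] by (rule countable_image)
  have pS: "p n x \<in> S" if "x \<in> S" for n x
    unfolding p_def by (rule inv_into_into) (use that in auto)
  have lim: "(\<lambda>n. p n x i) \<longlonglongrightarrow> x i" if x: "x \<in> S" and i: "i \<in> I" for x i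
  proof -
    have bd: "\<bar>p n x i - x i\<bar> \<le> 1 / real (Suc n)" for n
    proof -
      have "g n (p n x) = g n x"
        unfolding p_def by (rule f_inv_into_f[where f = "g n" and A = S]) (use x in auto)
      then have "\<lfloor>p n x i * real (Suc n)\<rfloor> = \<lfloor>x i * real (Suc n)\<rfloor>"
        using i by (auto simp: g_def restrict_def dest!: fun_cong[of _ _ i])
      then have "\<bar>p n x i * real (Suc n) - x i * real (Suc n)\<bar> \<le> 1" by linarith
      then have "\<bar>p n x i - x i\<bar> * real (Suc n) \<le> 1"
        by (simp add: abs_mult left_diff_distrib[symmetric])
      then show ?thesis by (simp add: field_simps)
    qed
    have "(\<lambda>n. p n x i - x i) \<longlonglongrightarrow> 0"
      by (rule Lim_null_comparison[OF _ LIMSEQ_inverse_real_of_nat])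
         (use bd in \<open>auto simp: inverse_eq_divide\<close>)
    then show ?thesis by (simp add: LIM_zero_iff)
  qed
  show ?thesis
  proof (rule that[of "\<Union>n. p n ` S"])
    show "(\<Union>n. p n ` S) \<subseteq> S" using pS by auto
    show "countable (\<Union>n. p n ` S)" using cnt by auto
    show "\<exists>y. (\<forall>n::nat. y n \<in> (\<Union>n. p n ` S)) \<and> (\<forall>i\<in>I. (\<lambda>n. y n i) \<longlonglongrightarrow> x i)"
      if "x \<in> S" for x
      by (rule exI[of _ "\<lambda>n. p n x"]) (use that lim in auto)
  qed
qed

section \<open>Gaussian measurements\<close>

text \<open>The hypothesis compares absolute values, so it passes through the exponential only in
  the even combination \<open>cosh\<close>; this is why both signs of \<open>l\<close> are brought
  in. The price is a factor 4 in the exponent, \<open>2 * l\<^sup>2 * \<tau>\<close> instead of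
  \<open>l\<^sup>2 * \<tau> / 2\<close>.\<close>

lemma (in prob_space) centered_exp_le:
  fixes Z h :: "'a \<Rightarrow> real"
  assumes [measurable]: "random_variable borel Z" "random_variable borel h"
    and Zh: "\<And>x. x \<in> space M \<Longrightarrow> \<bar>Z x\<bar> \<le> \<bar>h x\<bar>"
    and int_Z: "integrable M Z"
    and int_h: "\<And>a. integrable M (\<lambda>x. exp (a * h x))"
    and mgf: "\<And>a. expectation (\<lambda>x. exp (a * h x)) \<le> exp (a\<^sup>2 * \<tau> / 2)"
  shows "integrable M (\<lambda>x. exp (l * (Z x - expectation Z)))"
    and "expectation (\<lambda>x. exp (l * (Z x - expectation Z))) \<le> exp (2 * l\<^sup>2 * \<tau>)"
proof -
  have cosh: "exp x + exp (- x) \<le> exp y + exp (- y)" if "\<bar>x\<bar> \<le> \<bar>y\<bar>" for x y :: real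
  proof -
    have "cosh \<bar>x\<bar> \<le> cosh \<bar>y\<bar>" using that by (subst cosh_real_nonneg_le_iff) auto
    then have "cosh x \<le> cosh y" by simp
    then show ?thesis by (simp add: cosh_field_def)
  qed
  have int: "integrable M (\<lambda>x. exp (c * Z x))" for c
  proof (rule Bochner_Integration.integrable_bound)
    show "integrable M (\<lambda>x. exp (c * h x) + exp (- c * h x))"
      by (intro Bochner_Integration.integrable_add int_h)
    show "AE x in M. norm (exp (c * Z x)) \<le> norm (exp (c * h x) + exp (- c * h x))"
    proof (rule AE_I2)
      fix x assume "x \<in> space M"
      then have "\<bar>c * Z x\<bar> \<le> \<bar>c * h x\<bar>" using Zh by (simp add: abs_mult mult_left_mono)
      then have "exp (c * Z x) + exp (- (c * Z x)) \<le> exp (c * h x) + exp (- (c * h x))" by (rule cosh)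
      then have "exp (c * Z x) \<le> exp (c * h x) + exp (- (c * h x))"
        using exp_ge_zero[of "- (c * Z x)"] by linarith
      then show "norm (exp (c * Z x)) \<le> norm (exp (c * h x) + exp (- c * h x))" by simp
    qed
  qed simp
  define \<mu> where "\<mu> = expectation Z"
  define a where "a c = expectation (\<lambda>x. exp (c * Z x))" for c
  have split: "exp (l * (z - \<mu>)) = exp (- l * \<mu>) * exp (l * z)" for z
    by (simp add: exp_add[symmetric] algebra_simps)
  show "integrable M (\<lambda>x. exp (l * (Z x - expectation Z)))"
    unfolding \<mu>_def[symmetric] split using int[of l] by simp
  \<comment> \<open>Jensen's inequality, through the tangent of the exponential at the mean.\<close>
  have jensen: "exp (- l * \<mu>) \<le> a (- l)"
  proof -
    have "exp (- l * \<mu>) = expectation (\<lambda>x. exp (- l * \<mu>) * (1 - l * (Z x - \<mu>)))"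
      using int_Z by (simp add: prob_space \<mu>_def)
    also have "\<dots> \<le> a (- l)"
      unfolding a_def
    proof (rule integral_mono)
      show "exp (- l * \<mu>) * (1 - l * (Z x - \<mu>)) \<le> exp (- l * Z x)" for x
      proof -
        have "1 - l * (Z x - \<mu>) \<le> exp (- l * (Z x - \<mu>))"
          using exp_ge_add_one_self[of "- l * (Z x - \<mu>)"] by simp
        then have "exp (- l * \<mu>) * (1 - l * (Z x - \<mu>)) \<le> exp (- l * \<mu>) * exp (- l * (Z x - \<mu>))"
          by (rule mult_left_mono) simp
        then show ?thesis by (simp add: exp_add[symmetric] algebra_simps)
      qed
    qed (use int_Z int[of "- l"] in auto)
    finally show ?thesis .
  qed
  \<comment> \<open>Nonnegativity of the variance of \<open>exp (c * Z x)\<close>; it moves from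
    \<open>l\<close> to \<open>2 * l\<close> so that the product of the two moments can be bounded
    by a sum.\<close>
  have sq: "(a c)\<^sup>2 \<le> a (2 * c)" for c
  proof -
    have "0 \<le> expectation (\<lambda>x. (exp (c * Z x) - a c)\<^sup>2)" by (intro integral_nonneg_AE) auto
    also have "\<dots> = expectation (\<lambda>x. exp (2 * c * Z x) - 2 * a c * exp (c * Z x) + (a c)\<^sup>2)"
    proof (rule Bochner_Integration.integral_cong)
      fix x
      have "exp (2 * c * Z x) = (exp (c * Z x))\<^sup>2"
        by (simp add: power2_eq_square exp_add[symmetric])
      then show "(exp (c * Z x) - a c)\<^sup>2 = exp (2 * c * Z x) - 2 * a c * exp (c * Z x) + (a c)\<^sup>2"
        by (simp add: power2_diff)
    qed simp
    also have "\<dots> = a (2 * c) - 2 * a c * a c + (a c)\<^sup>2"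
      using int[of "2 * c"] int[of c] by (simp add: a_def prob_space)
    finally show ?thesis by (simp add: power2_eq_square)
  qed
  have "a (2 * l) + a (2 * - l) = expectation (\<lambda>x. exp (2 * l * Z x) + exp (2 * - l * Z x))"
    unfolding a_def by (rule Bochner_Integration.integral_add[symmetric]) (rule int)+
  also have "\<dots> \<le> expectation (\<lambda>x. exp (2 * l * h x) + exp (2 * - l * h x))"
  proof (rule integral_mono)
    fix x assume "x \<in> space M"
    then have "\<bar>2 * l * Z x\<bar> \<le> \<bar>2 * l * h x\<bar>" using Zh by (simp add: abs_mult mult_left_mono)
    from cosh[OF this] show "exp (2 * l * Z x) + exp (2 * - l * Z x) \<le> exp (2 * l * h x) + exp (2 * - l * h x)"
      by simp
  qed (intro Bochner_Integration.integrable_add int int_h)+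
  also have "\<dots> = expectation (\<lambda>x. exp (2 * l * h x)) + expectation (\<lambda>x. exp (2 * - l * h x))"
    using int_h by (intro Bochner_Integration.integral_add)
  also have "\<dots> \<le> 2 * exp (2 * l\<^sup>2 * \<tau>)"
    using mgf[of "2 * l"] mgf[of "2 * - l"] by (simp add: power2_eq_square mult_ac)
  finally have tot: "a (2 * l) + a (2 * - l) \<le> 2 * exp (2 * l\<^sup>2 * \<tau>)" .
  have a0: "0 \<le> a l" unfolding a_def by (intro integral_nonneg_AE) auto
  have "expectation (\<lambda>x. exp (l * (Z x - expectation Z))) = exp (- l * \<mu>) * a l"
    unfolding \<mu>_def[symmetric] split a_def by simp
  also have "\<dots> \<le> a (- l) * a l"
    by (rule mult_right_mono[OF jensen a0])
  also have "2 * (a (- l) * a l) \<le> (a l)\<^sup>2 + (a (- l))\<^sup>2"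
    using sum_squares_bound[of "a l" "a (- l)"] by (simp add: mult_ac)
  then have "a (- l) * a l \<le> exp (2 * l\<^sup>2 * \<tau>)"
    using sq[of l] sq[of "- l"] tot by linarith
  finally show "expectation (\<lambda>x. exp (l * (Z x - expectation Z))) \<le> exp (2 * l\<^sup>2 * \<tau>)" .
qed

section \<open>Law, moments and independence of the measurements\<close>

lemma prob_space_gaussian_measurement: "prob_space (gaussian_measurement m N d)"
  unfolding gaussian_measurement_def
  by (intro prob_space_PiM prob_space_normal_density) simp

lemma space_gaussian_measurement:
  "space (gaussian_measurement m N d) = PiE ({1..m} \<times> tensor_index N d) (\<lambda>_. UNIV)"
  by (simp add: gaussian_measurement_def space_PiM)

lemma measurable_gaussian_measurement_component [measurable]:
  assumes "k \<in> {1..m}" "s \<in> tensor_index N d"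
  shows "(\<lambda>A. A (k, s)) \<in> borel_measurable (gaussian_measurement m N d)"
proof -
  have "(\<lambda>A. A (k, s)) \<in> measurable (gaussian_measurement m N d) (density lborel std_normal_density)"
    unfolding gaussian_measurement_def using assms by (intro measurable_component_singleton) auto
  then show ?thesis by simp
qed

lemma measurable_measure_op [measurable]:
  assumes "k \<in> {1..m}"
  shows "(\<lambda>A. measure_op N d A X k) \<in> borel_measurable (gaussian_measurement m N d)"
  unfolding measure_op_def tensor_inner_def
  using assms by (intro borel_measurable_sum borel_measurable_times measurable_gaussian_measurement_component) auto

lemma measurable_l1_norm_measure_op [measurable]:
  "(\<lambda>A. l1_norm m (measure_op N d A X)) \<in> borel_measurable (gaussian_measurement m N d)"
  unfolding l1_norm_def by (intro borel_measurable_sum borel_measurable_abs measurable_measure_op)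

text \<open>\<open>iid_std_normal_iff_law\<close> for the coordinate maps: their joint map is the
  identity, as the points of the product space are extensional.\<close>

lemma gaussian_measurement_iid:
  assumes "{1..m} \<times> tensor_index N d \<noteq> {}"
  shows "prob_space.indep_vars (gaussian_measurement m N d) (\<lambda>_. borel) (\<lambda>i A. A i) ({1..m} \<times> tensor_index N d)"
    and "\<And>i. i \<in> {1..m} \<times> tensor_index N d \<Longrightarrow>
      distributed (gaussian_measurement m N d) lborel (\<lambda>A. A i) std_normal_density"
proof -
  let ?M = "gaussian_measurement m N d"
  interpret prob_space ?M by (rule prob_space_gaussian_measurement)
  have "distr ?M ?M (\<lambda>w. \<lambda>i\<in>{1..m} \<times> tensor_index N d. w i) = distr ?M ?M (\<lambda>w. w)"
    by (intro distr_cong refl) (auto simp: space_gaussian_measurement PiE_restrict)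
  also have "\<dots> = ?M" by simp
  finally have *: "distr ?M ?M (\<lambda>w. \<lambda>i\<in>{1..m} \<times> tensor_index N d. w i) = ?M" .
  have rv: "random_variable borel (\<lambda>A. A i)" if "i \<in> {1..m} \<times> tensor_index N d" for i
    using that by (cases i) auto
  note law = iid_std_normal_iff_law[where G = "\<lambda>i A. A i", OF assms rv]
  show "indep_vars (\<lambda>_. borel) (\<lambda>i A. A i) ({1..m} \<times> tensor_index N d)"
    using law * by blast
  show "distributed ?M lborel (\<lambda>A. A i) std_normal_density" if "i \<in> {1..m} \<times> tensor_index N d" for i
    using law * that by blast
qed

lemma measure_op_eq_0:
  assumes "frob_norm N d X = 0"
  shows "measure_op N d A X k = 0"
proof -
  have "\<forall>s\<in>tensor_index N d. X s = 0"
    using assms by (simp add: frob_norm_eq_L2_set L2_set_eq_0_iff finite_tensor_index)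
  then show ?thesis by (simp add: measure_op_def tensor_inner_def)
qed

lemma distributed_measure_op:
  assumes k: "k \<in> {1..m}" and X: "frob_norm N d X \<noteq> 0"
  shows "distributed (gaussian_measurement m N d) lborel (\<lambda>A. measure_op N d A X k)
           (normal_density 0 (frob_norm N d X))"
proof -
  let ?M = "gaussian_measurement m N d"
  interpret prob_space ?M by (rule prob_space_gaussian_measurement)
  \<comment> \<open>Zero coefficients are dropped, since a constant summand 0 has no density and is
    not a normal variable in the sense of \<open>distributed\<close>.\<close>
  define T where "T = {s \<in> tensor_index N d. X s \<noteq> 0}"
  have finT: "finite T" by (simp add: T_def finite_tensor_index)
  have sumT: "(\<Sum>s\<in>tensor_index N d. f s) = (\<Sum>s\<in>T. f s)" if "\<And>s. X s = 0 \<Longrightarrow> f s = 0" for f :: "_ \<Rightarrow> real"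
    by (rule sum.mono_neutral_right) (auto simp: T_def finite_tensor_index that)
  have "T \<noteq> {}"
  proof
    assume "T = {}"
    then have "\<forall>s\<in>tensor_index N d. X s = 0" by (auto simp: T_def)
    then show False using X by (simp add: frob_norm_def tensor_inner_def)
  qed
  define J where "J = {k} \<times> T"
  have J: "finite J" "J \<noteq> {}" "J \<subseteq> {1..m} \<times> tensor_index N d"
    using finT \<open>T \<noteq> {}\<close> k by (auto simp: J_def T_def)
  then have ne: "{1..m} \<times> tensor_index N d \<noteq> {}" by blast
  have ind: "indep_vars (\<lambda>_. borel) (\<lambda>i A. X (snd i) * A i) J"
    using indep_vars_compose2[OF indep_vars_subset[OF gaussian_measurement_iid(1)[OF ne] J(3)],
        of "\<lambda>i x. X (snd i) * x" "\<lambda>_. borel"] by simp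
  have nd: "distributed ?M lborel (\<lambda>A. X (snd i) * A i) (normal_density 0 \<bar>X (snd i)\<bar>)" if "i \<in> J" for i
    using normal_density_affine[OF gaussian_measurement_iid(2)[OF ne, of i], of "X (snd i)" 0] that J(3)
    by (auto simp: J_def T_def)
  have "distributed ?M lborel (\<lambda>A. \<Sum>i\<in>J. X (snd i) * A i)
      (normal_density (\<Sum>i\<in>J. 0) (sqrt (\<Sum>i\<in>J. \<bar>X (snd i)\<bar>\<^sup>2)))"
    by (rule sum_indep_normal[OF J(1,2) ind]) (use nd in \<open>auto simp: J_def T_def\<close>)
  moreover have "(\<Sum>i\<in>J. X (snd i) * A i) = measure_op N d A X k" for A
    unfolding measure_op_def tensor_inner_def
    by (subst sumT) (auto simp: J_def sum.cartesian_product' mult.commute)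
  moreover have "sqrt (\<Sum>i\<in>J. \<bar>X (snd i)\<bar>\<^sup>2) = frob_norm N d X"
    unfolding frob_norm_def tensor_inner_def
    by (subst sumT) (auto simp: J_def sum.cartesian_product' power2_eq_square)
  ultimately show ?thesis by simp
qed

text \<open>Completing the square: tilting by \<open>exp (a * x)\<close> shifts the mean, so
  integrability and value of the moment generating function are read off from another normal
  density.\<close>

lemma normal_density_mult_exp:
  assumes "\<sigma> > 0"
  shows "normal_density 0 \<sigma> x * exp (a * x) = exp (a\<^sup>2 * \<sigma>\<^sup>2 / 2) * normal_density (a * \<sigma>\<^sup>2) \<sigma> x"
proof -
  have "- (x - 0)\<^sup>2 / (2 * \<sigma>\<^sup>2) + a * x = a\<^sup>2 * \<sigma>\<^sup>2 / 2 + (- (x - a * \<sigma>\<^sup>2)\<^sup>2 / (2 * \<sigma>\<^sup>2))"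
    using assms by (simp add: field_simps power2_eq_square)
  then have "exp (- (x - 0)\<^sup>2 / (2 * \<sigma>\<^sup>2)) * exp (a * x) = exp (a\<^sup>2 * \<sigma>\<^sup>2 / 2) * exp (- (x - a * \<sigma>\<^sup>2)\<^sup>2 / (2 * \<sigma>\<^sup>2))"
    by (simp only: exp_add[symmetric])
  then show ?thesis by (simp add: normal_density_def)
qed

lemma mgf_measure_op:
  assumes k: "k \<in> {1..m}"
  shows "integrable (gaussian_measurement m N d) (\<lambda>A. exp (a * measure_op N d A X k))"
    and "(\<integral>A. exp (a * measure_op N d A X k) \<partial>gaussian_measurement m N d) = exp (a\<^sup>2 * (frob_norm N d X)\<^sup>2 / 2)"
proof -
  let ?M = "gaussian_measurement m N d"
  interpret prob_space ?M by (rule prob_space_gaussian_measurement)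
  define \<sigma> where "\<sigma> = frob_norm N d X"
  have "integrable ?M (\<lambda>A. exp (a * measure_op N d A X k)) \<and>
      expectation (\<lambda>A. exp (a * measure_op N d A X k)) = exp (a\<^sup>2 * \<sigma>\<^sup>2 / 2)"
  proof (cases "\<sigma> = 0")
    case True
    then show ?thesis using measure_op_eq_0[of N d X] by (simp add: \<sigma>_def prob_space)
  next
    case False
    then have \<sigma>: "\<sigma> > 0" by (simp add: \<sigma>_def frob_norm_eq_L2_set order_less_le)
    note D = distributed_measure_op[OF k False[unfolded \<sigma>_def], folded \<sigma>_def]
    have "integrable lborel (\<lambda>x. normal_density 0 \<sigma> x * exp (a * x))"
      unfolding normal_density_mult_exp[OF \<sigma>] using \<sigma> by simp
    then have "integrable ?M (\<lambda>A. exp (a * measure_op N d A X k))"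
      using distributed_integrable[OF D, of "\<lambda>x. exp (a * x)"] by simp
    moreover have "expectation (\<lambda>A. exp (a * measure_op N d A X k)) = exp (a\<^sup>2 * \<sigma>\<^sup>2 / 2)"
      using distributed_integral[OF D, of "\<lambda>x. exp (a * x)"] \<sigma> by (simp add: normal_density_mult_exp)
    ultimately show ?thesis ..
  qed
  then show "integrable ?M (\<lambda>A. exp (a * measure_op N d A X k))"
    "expectation (\<lambda>A. exp (a * measure_op N d A X k)) = exp (a\<^sup>2 * (frob_norm N d X)\<^sup>2 / 2)"
    by (simp_all add: \<sigma>_def)
qed

lemma abs_moment_measure_op:
  assumes k: "k \<in> {1..m}"
  shows "integrable (gaussian_measurement m N d) (\<lambda>A. \<bar>measure_op N d A X k\<bar>)"
    and "(\<integral>A. \<bar>measure_op N d A X k\<bar> \<partial>gaussian_measurement m N d) = sqrt (2 / pi) * frob_norm N d X"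
proof -
  let ?M = "gaussian_measurement m N d"
  interpret prob_space ?M by (rule prob_space_gaussian_measurement)
  define \<sigma> where "\<sigma> = frob_norm N d X"
  have "integrable ?M (\<lambda>A. \<bar>measure_op N d A X k\<bar>) \<and>
      expectation (\<lambda>A. \<bar>measure_op N d A X k\<bar>) = sqrt (2 / pi) * \<sigma>"
  proof (cases "\<sigma> = 0")
    case True
    then show ?thesis using measure_op_eq_0[of N d X] by (simp add: \<sigma>_def)
  next
    case False
    then have \<sigma>: "\<sigma> > 0" by (simp add: \<sigma>_def frob_norm_eq_L2_set order_less_le)
    note D = distributed_measure_op[OF k False[unfolded \<sigma>_def], folded \<sigma>_def]
    have "has_bochner_integral lborel (\<lambda>x. normal_density 0 \<sigma> x * \<bar>x\<bar>) (\<sigma> * sqrt (2 / pi))"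
      using normal_moment_abs_odd[OF \<sigma>, of 0 0] by simp
    then show ?thesis
      using distributed_integrable[OF D, of "\<lambda>x. \<bar>x\<bar>"] distributed_integral[OF D, of "\<lambda>x. \<bar>x\<bar>"] \<sigma>
      by (simp add: has_bochner_integral_iff mult.commute)
  qed
  then show "integrable ?M (\<lambda>A. \<bar>measure_op N d A X k\<bar>)"
    "expectation (\<lambda>A. \<bar>measure_op N d A X k\<bar>) = sqrt (2 / pi) * frob_norm N d X"
    by (simp_all add: \<sigma>_def)
qed

section \<open>Subgaussian increments of the deviation\<close>

definition l1_deviation :: "nat \<Rightarrow> nat \<Rightarrow> (nat \<Rightarrow> nat) \<Rightarrow> measurement \<Rightarrow> tensor \<Rightarrow> real" where
  "l1_deviation m N d A X = 1 / real m * l1_norm m (measure_op N d A X) - sqrt (2 / pi) * frob_norm N d X"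

lemma measurable_l1_deviation [measurable]:
  "(\<lambda>A. l1_deviation m N d A X) \<in> borel_measurable (gaussian_measurement m N d)"
  unfolding l1_deviation_def by measurable

text \<open>The measurements with number \<open>k\<close> read only the block
  \<open>{k} \<times> tensor_index N d\<close> of entries, and different blocks are disjoint. Two
  tensors are allowed because an increment involves both.\<close>

lemma indep_vars_measure_op:
  assumes "{1..m} \<times> tensor_index N d \<noteq> {}"
    and [measurable]: "case_prod f \<in> borel_measurable (borel \<Otimes>\<^sub>M borel)"
  shows "prob_space.indep_vars (gaussian_measurement m N d) (\<lambda>_. borel)
    (\<lambda>k A. f (measure_op N d A X k) (measure_op N d A Y k) :: real) {1..m}"
proof -
  let ?M = "gaussian_measurement m N d"
  let ?T = "tensor_index N d"
  interpret prob_space ?M by (rule prob_space_gaussian_measurement)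
  define F where "F k w = f (\<Sum>s\<in>?T. w (k, s) * X s) (\<Sum>s\<in>?T. w (k, s) * Y s)" for k :: nat and w
  have "indep_vars (\<lambda>k. PiM ({k} \<times> ?T) (\<lambda>_. borel))
      (\<lambda>k w. restrict (\<lambda>i. w i) ({k} \<times> ?T)) {1..m}"
    by (rule indep_vars_restrict[OF gaussian_measurement_iid(1)[OF assms(1)]])
       (auto simp: disjoint_family_on_def)
  moreover have "F k \<in> borel_measurable (PiM ({k} \<times> ?T) (\<lambda>_. borel :: real measure))" for k
  proof -
    have [measurable]: "(\<lambda>w. w (k, s)) \<in> borel_measurable (PiM ({k} \<times> ?T) (\<lambda>_. borel :: real measure))"
      if "s \<in> ?T" for s
      using that by (intro measurable_component_singleton) auto
    have [measurable]: "(\<lambda>w. \<Sum>s\<in>?T. w (k, s) * Z s) \<in> borel_measurable (PiM ({k} \<times> ?T) (\<lambda>_. borel :: real measure))"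
      for Z :: tensor
      by (intro borel_measurable_sum borel_measurable_times) auto
    show ?thesis unfolding F_def by measurable
  qed
  ultimately have "indep_vars (\<lambda>_. borel) (\<lambda>k w. F k (restrict (\<lambda>i. w i) ({k} \<times> ?T))) {1..m}"
    by (rule indep_vars_compose2)
  moreover have "F k (restrict (\<lambda>i. A i) ({k} \<times> ?T)) = f (measure_op N d A X k) (measure_op N d A Y k)" for k A
    by (simp add: F_def measure_op_def tensor_inner_def cong: sum.cong)
  ultimately show ?thesis by simp
qed

text \<open>Chernoff's bound for a sum of \<open>m\<close> independent centred differences.
  \<open>\<rho>\<close> is any positive bound on the distance, so coinciding tensors need no
  separate case.\<close>

lemma l1_deviation_increment_tail:
  assumes ne: "{1..m} \<times> tensor_index N d \<noteq> {}" and \<rho>: "\<rho> > 0" "frob_norm N d (\<lambda>s. X s - Y s) \<le> \<rho>" and u: "u > 0"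
  shows "measure (gaussian_measurement m N d)
     {A \<in> space (gaussian_measurement m N d). u \<le> l1_deviation m N d A X - l1_deviation m N d A Y}
     \<le> exp (- (real m * u\<^sup>2 / (8 * \<rho>\<^sup>2)))"
proof -
  let ?M = "gaussian_measurement m N d"
  interpret prob_space ?M by (rule prob_space_gaussian_measurement)
  have m: "m > 0" using ne by (cases m) auto
  define W where "W k A = \<bar>measure_op N d A X k\<bar> - \<bar>measure_op N d A Y k\<bar>" for k A
  define \<mu> where "\<mu> = sqrt (2 / pi) * (frob_norm N d X - frob_norm N d Y)"
  \<comment> \<open>The minimiser of the exponent
    \<open>- l * m * u + 2 * m * l\<^sup>2 * \<rho>\<^sup>2\<close>.\<close>
  define l where "l = u / (4 * \<rho>\<^sup>2)"
  have l: "l > 0" using u \<rho> by (simp add: l_def)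
  have EW: "expectation (W k) = \<mu>" and intW: "integrable ?M (W k)" if k: "k \<in> {1..m}" for k
    using abs_moment_measure_op[OF k, of N d] by (simp_all add: W_def[abs_def] \<mu>_def right_diff_distrib)
  have E: "integrable ?M (\<lambda>A. exp (l * (W k A - \<mu>))) \<and>
      expectation (\<lambda>A. exp (l * (W k A - \<mu>))) \<le> exp (2 * l\<^sup>2 * \<rho>\<^sup>2)" if k: "k \<in> {1..m}" for k
  proof -
    have [measurable]: "(\<lambda>A. measure_op N d A Z k) \<in> borel_measurable ?M" for Z
      by (rule measurable_measure_op[OF k])
    have W[measurable]: "W k \<in> borel_measurable ?M" unfolding W_def by measurable
    \<comment> \<open>By linearity and the reverse triangle inequality,
      \<open>\<bar>W k A\<bar>\<close> is at most the absolute value of the Gaussian measurement of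
      \<open>X - Y\<close>.\<close>
    have diff: "measure_op N d A (\<lambda>s. X s - Y s) k = measure_op N d A X k - measure_op N d A Y k" for A
      by (simp add: measure_op_def tensor_inner_def right_diff_distrib sum_subtractf)
    have "(frob_norm N d (\<lambda>s. X s - Y s))\<^sup>2 \<le> \<rho>\<^sup>2"
      using \<rho> by (intro power_mono) (auto simp: frob_norm_eq_L2_set)
    then have "expectation (\<lambda>A. exp (a * measure_op N d A (\<lambda>s. X s - Y s) k)) \<le> exp (a\<^sup>2 * \<rho>\<^sup>2 / 2)" for a
      by (simp add: mgf_measure_op[OF k] mult_left_mono)
    from centered_exp_le[OF W _ _ intW[OF k] mgf_measure_op(1)[OF k] this, of l]
    show ?thesis by (auto simp: EW[OF k] diff W_def)
  qed
  have "indep_vars (\<lambda>_. borel) (\<lambda>k A. exp (l * (\<bar>measure_op N d A X k\<bar> - \<bar>measure_op N d A Y k\<bar> - \<mu>))) {1..m}"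
    by (rule indep_vars_measure_op[OF ne]) measurable
  then have ind: "indep_vars (\<lambda>_. borel) (\<lambda>k A. exp (l * (W k A - \<mu>))) {1..m}"
    by (simp add: W_def)
  define S where "S A = (\<Sum>k\<in>{1..m}. W k A - \<mu>)" for A
  have expS: "exp (l * S A) = (\<Prod>k\<in>{1..m}. exp (l * (W k A - \<mu>)))" for A
    by (simp add: S_def exp_sum[symmetric] sum_distrib_left)
  have intS: "integrable ?M (\<lambda>A. exp (l * S A))"
    unfolding expS using E by (intro indep_vars_integrable ind) auto
  have "expectation (\<lambda>A. exp (l * S A)) = (\<Prod>k\<in>{1..m}. expectation (\<lambda>A. exp (l * (W k A - \<mu>))))"
    unfolding expS using E by (intro indep_vars_lebesgue_integral ind) auto
  also have "\<dots> \<le> (\<Prod>k\<in>{1..m}. exp (2 * l\<^sup>2 * \<rho>\<^sup>2))"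
    using E by (intro prod_mono) (auto intro!: integral_nonneg_AE)
  also have "\<dots> = exp (real m * (2 * l\<^sup>2 * \<rho>\<^sup>2))" by (simp add: exp_of_nat_mult)
  finally have ES: "expectation (\<lambda>A. exp (l * S A)) \<le> exp (real m * (2 * l\<^sup>2 * \<rho>\<^sup>2))" .
  have dev: "l1_deviation m N d A X - l1_deviation m N d A Y = S A / real m" for A
  proof -
    have "S A = (\<Sum>k\<in>{1..m}. \<bar>measure_op N d A X k\<bar>) - (\<Sum>k\<in>{1..m}. \<bar>measure_op N d A Y k\<bar>) - real m * \<mu>"
      by (simp add: S_def W_def sum_subtractf)
    moreover have "1 / real m * a - c * x - (1 / real m * b - c * y) = (a - b - real m * (c * (x - y))) / real m"
      for a b c x y :: real
      using m by (simp add: field_simps)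
    ultimately show ?thesis
      by (simp only: l1_deviation_def l1_norm_def \<mu>_def)
  qed
  have "{A \<in> space ?M. u \<le> l1_deviation m N d A X - l1_deviation m N d A Y} = {A \<in> space ?M. real m * u \<le> S A}"
    using m by (auto simp: dev field_simps)
  then have "prob {A \<in> space ?M. u \<le> l1_deviation m N d A X - l1_deviation m N d A Y}
      \<le> exp (- l * (real m * u)) * expectation (\<lambda>A. exp (l * S A))"
    using Chernoff_ineq_ge[OF l, of "space ?M" S "real m * u"] intS
    by (simp add: set_integrable_def set_lebesgue_integral_def integrable_mult_indicator
        cong: Bochner_Integration.integral_cong Bochner_Integration.integrable_cong)
  also have "\<dots> \<le> exp (- l * (real m * u)) * exp (real m * (2 * l\<^sup>2 * \<rho>\<^sup>2))"
    by (intro mult_left_mono ES) simp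
  also have "\<dots> = exp (- (real m * u\<^sup>2 / (8 * \<rho>\<^sup>2)))"
    unfolding exp_add[symmetric] using \<rho>(1) by (simp add: l_def field_simps power2_eq_square)
  finally show ?thesis .
qed

lemma l1_deviation_increment_abs_tail:
  assumes ne: "{1..m} \<times> tensor_index N d \<noteq> {}" and \<rho>: "\<rho> > 0" "frob_norm N d (\<lambda>s. X s - Y s) \<le> \<rho>" and u: "u > 0"
  shows "measure (gaussian_measurement m N d)
     {A \<in> space (gaussian_measurement m N d). u \<le> \<bar>l1_deviation m N d A X - l1_deviation m N d A Y\<bar>}
     \<le> 2 * exp (- (real m * u\<^sup>2 / (8 * \<rho>\<^sup>2)))"
proof -
  let ?M = "gaussian_measurement m N d"
  interpret prob_space ?M by (rule prob_space_gaussian_measurement)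
  let ?B = "\<lambda>X Y. {A \<in> space ?M. u \<le> l1_deviation m N d A X - l1_deviation m N d A Y}"
  have "frob_norm N d (\<lambda>s. Y s - X s) = frob_norm N d (\<lambda>s. X s - Y s)"
    by (simp add: frob_norm_eq_L2_set L2_set_def power2_commute)
  then have \<rho>': "frob_norm N d (\<lambda>s. Y s - X s) \<le> \<rho>" using \<rho> by simp
  have "{A \<in> space ?M. u \<le> \<bar>l1_deviation m N d A X - l1_deviation m N d A Y\<bar>} = ?B X Y \<union> ?B Y X"
    by (auto simp: abs_if)
  then have "prob {A \<in> space ?M. u \<le> \<bar>l1_deviation m N d A X - l1_deviation m N d A Y\<bar>} \<le> prob (?B X Y) + prob (?B Y X)"
    by (simp add: measure_Un_le)
  then show ?thesis
    using l1_deviation_increment_tail[OF ne \<rho> u] l1_deviation_increment_tail[OF ne \<rho>(1) \<rho>' u] by linarith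
qed

section \<open>Chaining\<close>

lemma tendsto_frob_norm:
  assumes "\<And>s. s \<in> tensor_index N d \<Longrightarrow> (\<lambda>n. Y n s) \<longlonglongrightarrow> X s"
  shows "(\<lambda>n. frob_norm N d (Y n)) \<longlonglongrightarrow> frob_norm N d X"
  unfolding frob_norm_def tensor_inner_def by (intro tendsto_intros assms)

lemma tendsto_l1_deviation:
  assumes "\<And>s. s \<in> tensor_index N d \<Longrightarrow> (\<lambda>n. Y n s) \<longlonglongrightarrow> X s"
  shows "(\<lambda>n. l1_deviation m N d A (Y n)) \<longlonglongrightarrow> l1_deviation m N d A X"
  unfolding l1_deviation_def l1_norm_def measure_op_def tensor_inner_def
  by (intro tendsto_intros tendsto_frob_norm assms)

text \<open>Reduces all tensors to those of norm at most 1; with \<open>\<rho> = 0\<close> it also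
  gives deviation 0 at the zero tensor.\<close>

lemma l1_deviation_scale:
  assumes "\<And>s. s \<in> tensor_index N d \<Longrightarrow> X s = \<rho> * Y s"
  shows "l1_deviation m N d A X = \<bar>\<rho>\<bar> * l1_deviation m N d A Y"
proof -
  have 1: "measure_op N d A X k = \<rho> * measure_op N d A Y k" for k
    unfolding measure_op_def tensor_inner_def sum_distrib_left
    by (intro sum.cong refl) (simp add: assms)
  have "tensor_inner N d X X = \<rho>\<^sup>2 * tensor_inner N d Y Y"
    unfolding tensor_inner_def sum_distrib_left
    by (intro sum.cong refl) (simp add: assms power2_eq_square)
  then have "frob_norm N d X = \<bar>\<rho>\<bar> * frob_norm N d Y"
    by (simp add: frob_norm_def real_sqrt_mult)
  then show ?thesis
    unfolding l1_deviation_def l1_norm_def 1 abs_mult sum_distrib_left[symmetric]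
    by (simp add: right_diff_distrib)
qed

text \<open>The event is an uncountable intersection, and \<open>measure\<close> would be 0 if it
  were not measurable. Both sides of the inequality are continuous for entrywise convergence, so a
  countable dense subset of the tensors in question decides.\<close>

lemma sets_l1_deviation_all:
  "{A \<in> space (gaussian_measurement m N d). \<forall>X. P X \<longrightarrow> \<bar>l1_deviation m N d A X\<bar> \<le> \<delta> * frob_norm N d X}
     \<in> sets (gaussian_measurement m N d)"
proof -
  let ?M = "gaussian_measurement m N d"
  obtain C where C: "C \<subseteq> Collect P" "countable C"
    and dense: "\<And>X. X \<in> Collect P \<Longrightarrow>
      \<exists>Y. (\<forall>n::nat. Y n \<in> C) \<and> (\<forall>s\<in>tensor_index N d. (\<lambda>n. Y n s) \<longlonglongrightarrow> X s)"
  proof (rule countable_dense_functions[OF finite_tensor_index[of N d], where S = "Collect P"], goal_cases)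
    case (1 C)
    show ?case by (rule 1(1)[of C]) (fact 1(2-4))+
  qed
  have "\<bar>l1_deviation m N d A X\<bar> \<le> \<delta> * frob_norm N d X"
    if A: "\<forall>X\<in>C. \<bar>l1_deviation m N d A X\<bar> \<le> \<delta> * frob_norm N d X" and X: "P X" for A X
  proof -
    obtain Y where Y: "\<And>n::nat. Y n \<in> C" "\<And>s. s \<in> tensor_index N d \<Longrightarrow> (\<lambda>n. Y n s) \<longlonglongrightarrow> X s"
      using dense[of X] X by auto
    show ?thesis
    proof (rule LIMSEQ_le)
      show "(\<lambda>n. \<bar>l1_deviation m N d A (Y n)\<bar>) \<longlonglongrightarrow> \<bar>l1_deviation m N d A X\<bar>"
        by (intro tendsto_rabs tendsto_l1_deviation Y)
      show "(\<lambda>n. \<delta> * frob_norm N d (Y n)) \<longlonglongrightarrow> \<delta> * frob_norm N d X"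
        by (intro tendsto_mult_left tendsto_frob_norm Y)
      show "\<exists>n0. \<forall>n\<ge>n0. \<bar>l1_deviation m N d A (Y n)\<bar> \<le> \<delta> * frob_norm N d (Y n)"
        using A Y by blast
    qed
  qed
  then have "{A \<in> space ?M. \<forall>X. P X \<longrightarrow> \<bar>l1_deviation m N d A X\<bar> \<le> \<delta> * frob_norm N d X}
      = {A \<in> space ?M. \<forall>X\<in>C. \<bar>l1_deviation m N d A X\<bar> \<le> \<delta> * frob_norm N d X}"
    using C(1) by blast
  also have "\<dots> \<in> sets ?M"
    by (intro sets.sets_Collect_countable_All' C(2)) measurable
  finally show ?thesis .
qed

section \<open>One chain of approximations, and the probability of a bad increment at one
  scale\<close>

lemma frob_norm_diff_triangle:
  "frob_norm N d (\<lambda>s. X s - Z s) \<le> frob_norm N d (\<lambda>s. X s - Y s) + frob_norm N d (\<lambda>s. Y s - Z s)"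
  using L2_set_triangle_ineq[of "\<lambda>s. X s - Y s" "\<lambda>s. Y s - Z s" "tensor_index N d"]
  by (simp add: frob_norm_eq_L2_set)

lemma frob_norm_diff_commute:
  "frob_norm N d (\<lambda>s. X s - Y s) = frob_norm N d (\<lambda>s. Y s - X s)"
  by (simp add: frob_norm_eq_L2_set L2_set_def power2_commute)

text \<open>Telescoping from the zero tensor, whose deviation is 0: the increments
  \<open>\<delta> / 4 * (3 / 4) ^ j\<close> sum to \<open>\<delta>\<close>, and successive
  approximations of \<open>X\<close> are at most \<open>2 * (1 / 2) ^ j\<close> apart. The argument
  is deterministic, for a fixed \<open>A\<close>.\<close>

lemma l1_deviation_chaining:
  fixes S :: "nat \<Rightarrow> tensor set"
  assumes S0: "S 0 = {\<lambda>_. 0}"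
    and approx: "\<And>j. \<exists>Y\<in>S j. frob_norm N d (\<lambda>s. X s - Y s) \<le> (1 / 2) ^ j"
    and incr: "\<And>j Y Z. Y \<in> S j \<Longrightarrow> Z \<in> S (Suc j) \<Longrightarrow> frob_norm N d (\<lambda>s. Y s - Z s) \<le> 2 * (1 / 2) ^ j \<Longrightarrow>
       \<bar>l1_deviation m N d A Y - l1_deviation m N d A Z\<bar> \<le> \<delta> / 4 * (3 / 4) ^ j"
    and \<delta>: "\<delta> \<ge> 0"
  shows "\<bar>l1_deviation m N d A X\<bar> \<le> \<delta>"
proof -
  obtain Y where YS: "\<And>j. Y j \<in> S j" and Y: "\<And>j. frob_norm N d (\<lambda>s. X s - Y j s) \<le> (1 / 2) ^ j"
  proof -
    have "\<forall>j. \<exists>Y. Y \<in> S j \<and> frob_norm N d (\<lambda>s. X s - Y s) \<le> (1 / 2) ^ j"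
      using approx by blast
    then have "\<exists>Y. \<forall>j. Y j \<in> S j \<and> frob_norm N d (\<lambda>s. X s - Y j s) \<le> (1 / 2) ^ j"
      by (rule choice)
    then show ?thesis using that by blast
  qed
  have Y0: "l1_deviation m N d A (Y 0) = 0"
    using YS[of 0] S0 l1_deviation_scale[of N d "Y 0" 0 "Y 0" m A] by simp
  have bd: "\<bar>l1_deviation m N d A (Y n)\<bar> \<le> \<delta> * (1 - (3 / 4) ^ n)" for n
  proof (induction n)
    case (Suc n)
    have "frob_norm N d (\<lambda>s. Y n s - Y (Suc n) s) \<le> (1 / 2) ^ n + (1 / 2) ^ Suc n"
      using frob_norm_diff_triangle[of N d "Y n" "Y (Suc n)" X] Y[of n] Y[of "Suc n"]
      by (simp add: frob_norm_diff_commute[of N d "Y n" X])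
    also have "\<dots> \<le> 2 * (1 / 2) ^ n" by simp
    finally have "\<bar>l1_deviation m N d A (Y n) - l1_deviation m N d A (Y (Suc n))\<bar> \<le> \<delta> / 4 * (3 / 4) ^ n"
      by (rule incr[OF YS YS])
    then have "\<bar>l1_deviation m N d A (Y (Suc n))\<bar> \<le> \<delta> * (1 - (3 / 4) ^ n) + \<delta> / 4 * (3 / 4) ^ n"
      using Suc.IH by linarith
    then show ?case by (simp add: algebra_simps)
  qed (simp add: Y0)
  have lim: "(\<lambda>n. Y n s) \<longlonglongrightarrow> X s" if s: "s \<in> tensor_index N d" for s
  proof -
    have bd: "\<bar>Y n s - X s\<bar> \<le> (1 / 2) ^ n" for n
    proof -
      have "\<bar>X s - Y n s\<bar> \<le> L2_set (\<lambda>s. \<bar>X s - Y n s\<bar>) (tensor_index N d)"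
        by (rule member_le_L2_set[OF finite_tensor_index s])
      also have "\<dots> = frob_norm N d (\<lambda>s. X s - Y n s)"
        by (simp add: frob_norm_eq_L2_set L2_set_def)
      finally show ?thesis using Y[of n] by (simp add: abs_minus_commute)
    qed
    have "(\<lambda>n. Y n s - X s) \<longlonglongrightarrow> 0"
    proof (rule Lim_null_comparison)
      show "\<forall>\<^sub>F n in sequentially. norm (Y n s - X s) \<le> (1 / 2) ^ n"
        using bd by (intro always_eventually allI) (simp only: real_norm_def)
      show "(\<lambda>n. (1 / 2 :: real) ^ n) \<longlonglongrightarrow> 0"
        by (rule LIMSEQ_realpow_zero) auto
    qed
    then show ?thesis by (simp add: LIM_zero_iff)
  qed
  show ?thesis
  proof (rule LIMSEQ_le_const2)
    show "(\<lambda>n. \<bar>l1_deviation m N d A (Y n)\<bar>) \<longlonglongrightarrow> \<bar>l1_deviation m N d A X\<bar>"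
      by (intro tendsto_rabs tendsto_l1_deviation lim)
    have "\<bar>l1_deviation m N d A (Y n)\<bar> \<le> \<delta>" for n
    proof -
      have "\<delta> * (1 - (3 / 4) ^ n) \<le> \<delta>" using \<delta> mult_left_mono[of "1 - (3 / 4) ^ n" 1 \<delta>] by simp
      then show ?thesis using bd[of n] by linarith
    qed
    then show "\<exists>n0. \<forall>n\<ge>n0. \<bar>l1_deviation m N d A (Y n)\<bar> \<le> \<delta>" by blast
  qed
qed

text \<open>The union bound runs over all close pairs, so no map from the finer net to the coarser
  one has to be fixed. The price is the product of both net sizes, which affects only constants in
  the exponent.\<close>

lemma l1_deviation_level_tail:
  fixes S T :: "tensor set"
  assumes ne: "{1..m} \<times> tensor_index N d \<noteq> {}" and fin: "finite S" "finite T" and \<rho>: "\<rho> > 0" and u: "u > 0"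
  defines "Bad \<equiv> \<Union>(Y, Z)\<in>{(Y, Z) \<in> S \<times> T. frob_norm N d (\<lambda>s. Y s - Z s) \<le> \<rho>}.
      {A \<in> space (gaussian_measurement m N d). u \<le> \<bar>l1_deviation m N d A Y - l1_deviation m N d A Z\<bar>}"
  shows "Bad \<in> sets (gaussian_measurement m N d)"
    and "measure (gaussian_measurement m N d) Bad
      \<le> real (card S) * real (card T) * (2 * exp (- (real m * u\<^sup>2 / (8 * \<rho>\<^sup>2))))"
proof -
  let ?M = "gaussian_measurement m N d"
  let ?I = "{(Y, Z) \<in> S \<times> T. frob_norm N d (\<lambda>s. Y s - Z s) \<le> \<rho>}"
  let ?B = "\<lambda>(Y, Z). {A \<in> space ?M. u \<le> \<bar>l1_deviation m N d A Y - l1_deviation m N d A Z\<bar>}"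
  have finI: "finite ?I" using fin by (auto intro: finite_subset[of _ "S \<times> T"])
  have meas: "?B p \<in> sets ?M" for p by (cases p) simp
  show "Bad \<in> sets ?M" unfolding Bad_def using finI meas by (intro sets.finite_UN) auto
  have "measure ?M Bad \<le> (\<Sum>p\<in>?I. measure ?M (?B p))"
    unfolding Bad_def by (rule measure_UNION_le[OF finI meas])
  also have "\<dots> \<le> (\<Sum>p\<in>?I. 2 * exp (- (real m * u\<^sup>2 / (8 * \<rho>\<^sup>2))))"
    by (rule sum_mono) (auto intro: l1_deviation_increment_abs_tail[OF ne \<rho> _ u])
  also have "\<dots> = real (card ?I) * (2 * exp (- (real m * u\<^sup>2 / (8 * \<rho>\<^sup>2))))" by simp
  also have "\<dots> \<le> real (card (S \<times> T)) * (2 * exp (- (real m * u\<^sup>2 / (8 * \<rho>\<^sup>2))))"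
    using fin by (intro mult_right_mono of_nat_mono card_mono) auto
  finally show "measure ?M Bad \<le> real (card S) * real (card T) * (2 * exp (- (real m * u\<^sup>2 / (8 * \<rho>\<^sup>2))))"
    by (simp add: card_cartesian_product)
qed

text \<open>With \<open>K = Q * ln N\<close>, both nets together have entropy at most
  \<open>18 * K * (j + 1)\<close>, while the tail exponent is at least
  \<open>20 * K * (j + 1)\<close>. The surplus \<open>2 * K * (j + 1)\<close> makes the levels
  summable.\<close>

lemma chaining_level_bound:
  fixes N Q m j :: nat and \<delta> a b :: real
  assumes N: "N \<ge> 2" and a: "0 \<le> a" "a \<le> (128 * real N / (1 / 2) ^ j) ^ Q"
    and b: "0 \<le> b" "b \<le> (128 * real N / (1 / 2) ^ Suc j) ^ Q"
    and m: "10240 * (real Q * ln (real N)) \<le> real m * \<delta>\<^sup>2"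
  shows "a * b * (2 * exp (- (real m * (\<delta> / 4 * (3 / 4) ^ j)\<^sup>2 / (8 * (2 * (1 / 2) ^ j)\<^sup>2))))
     \<le> 2 * exp (- 2 * (real Q * ln (real N))) ^ Suc j"
proof -
  define K where "K = real Q * ln (real N)"
  have K: "K \<ge> 0" using N by (simp add: K_def)
  define x where "x = 128 * real N * 2 ^ Suc j"
  have xj: "128 * real N / (1 / 2) ^ j \<le> x" "128 * real N / (1 / 2) ^ Suc j = x"
    by (simp_all add: x_def power_divide)
  \<comment> \<open>\<open>N \<ge> 2\<close> absorbs the constants into powers of \<open>N\<close>:
    \<open>128 = 2 ^ 7\<close>, one factor \<open>N\<close>, and \<open>2 ^ Suc j\<close>, with
    \<open>7 + 1 + (j + 1) \<le> 9 * (j + 1)\<close>.\<close>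
  have "x \<le> real N ^ (9 * Suc j)"
  proof -
    have "(128::real) = 2 ^ 7" by simp
    also have "\<dots> \<le> real N ^ 7" using N by (intro power_mono) auto
    finally have "x \<le> real N ^ 7 * real N * real N ^ Suc j"
      unfolding x_def using N by (intro mult_mono power_mono) auto
    also have "\<dots> = real N ^ (9 + j)" by (simp add: power_add eval_nat_numeral)
    also have "\<dots> \<le> real N ^ (9 * Suc j)" using N by (intro power_increasing) auto
    finally show ?thesis .
  qed
  then have xQ: "x ^ Q \<le> (real N ^ (9 * Suc j)) ^ Q"
    by (intro power_mono) (auto simp: x_def)
  have "(real N ^ (9 * Suc j)) ^ Q = exp (9 * real (Suc j) * K)"
  proof -
    have "(real N ^ (9 * Suc j)) ^ Q = exp (ln (real N)) ^ (9 * Suc j * Q)"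
      using N by (simp add: power_mult)
    also have "\<dots> = exp (real (9 * Suc j * Q) * ln (real N))" by (simp only: exp_of_nat_mult)
    finally show ?thesis by (simp add: K_def mult_ac)
  qed
  with xQ have xQ: "x ^ Q \<le> exp (9 * real (Suc j) * K)" by simp
  have "a \<le> x ^ Q"
    using a(2) power_mono[OF xj(1), of Q] by simp
  moreover have "b \<le> x ^ Q" using b(2) xj(2) by simp
  ultimately have "a * b \<le> exp (9 * real (Suc j) * K) * exp (9 * real (Suc j) * K)"
    using a b xQ by (intro mult_mono) auto
  also have "\<dots> = exp (18 * real (Suc j) * K)" by (simp add: exp_add[symmetric])
  finally have ab: "a * b \<le> exp (18 * real (Suc j) * K)" .
  \<comment> \<open>512 is \<open>16 * 8 * 4\<close>, from the squares of
    \<open>\<delta> / 4\<close> and of the 2 in the distance and from the 8 of the tail bound;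
    \<open>10240 = 20 * 512\<close>. The base \<open>9 / 4\<close> is the square of
    \<open>(3 / 4) / (1 / 2)\<close>.\<close>
  have e: "real m * (\<delta> / 4 * (3 / 4) ^ j)\<^sup>2 / (8 * (2 * (1 / 2) ^ j)\<^sup>2) = real m * \<delta>\<^sup>2 / 512 * (9 / 4) ^ j"
  proof -
    have "((3 / 4 :: real) ^ j)\<^sup>2 = (9 / 4) ^ j * ((1 / 2) ^ j)\<^sup>2"
      by (simp add: power_mult[symmetric] mult.commute[of j] power_mult power2_eq_square power_mult_distrib[symmetric])
    then show ?thesis by (simp add: power_mult_distrib power_divide field_simps)
  qed
  have "real (Suc j) \<le> (9 / 4) ^ j"
  proof -
    have "real (Suc j) \<le> 1 + real j * (5 / 4)" by simp
    also have "\<dots> \<le> (1 + 5 / 4) ^ j" by (rule Bernoulli_inequality) simp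
    finally show ?thesis by simp
  qed
  then have "20 * K * real (Suc j) \<le> real m * \<delta>\<^sup>2 / 512 * (9 / 4) ^ j"
    using m K by (intro mult_mono) (auto simp: K_def)
  then have "exp (- (real m * (\<delta> / 4 * (3 / 4) ^ j)\<^sup>2 / (8 * (2 * (1 / 2) ^ j)\<^sup>2))) \<le> exp (- (20 * K * real (Suc j)))"
    unfolding e by simp
  then have "a * b * (2 * exp (- (real m * (\<delta> / 4 * (3 / 4) ^ j)\<^sup>2 / (8 * (2 * (1 / 2) ^ j)\<^sup>2))))
      \<le> exp (18 * real (Suc j) * K) * (2 * exp (- (20 * K * real (Suc j))))"
    using ab by (intro mult_mono) auto
  also have "\<dots> = 2 * exp (real (Suc j) * (- 2 * K))"
    by (simp add: exp_add[symmetric] algebra_simps)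
  also have "\<dots> = 2 * exp (- 2 * K) ^ Suc j" by (simp only: exp_of_nat_mult)
  finally show ?thesis by (simp add: K_def)
qed

section \<open>Union over all scales and the final probability\<close>

lemma tt_rank_le:
  assumes "N \<ge> 2" "\<forall>i\<in>{1..N - 1}. r i > 0"
  shows "tt_rank N r i \<le> Max (r ` {1..N - 1})"
proof (cases "i \<in> {1..<N}")
  case True
  then show ?thesis by (auto simp: tt_rank_def intro!: Max_ge)
next
  case False
  have "1 \<in> {1..N - 1}" using assms(1) by auto
  then have "0 < r 1" using assms(2) by blast
  then have "1 \<le> r 1" by simp
  also have "r 1 \<le> Max (r ` {1..N - 1})" using assms(1) by (intro Max_ge imageI) auto
  finally show ?thesis by (simp only: tt_rank_def False if_False)
qed

text \<open>One exceptional set, the union of all \<open>Bad j\<close>, serves every tensor train at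
  once: it depends on the nets only, and outside it the chaining is deterministic.\<close>

lemma tt_l1_deviation_prob:
  fixes N m :: nat and d r :: "nat \<Rightarrow> nat" and \<delta> :: real
  assumes N: "N \<ge> 2" and d: "\<forall>i\<in>{1..N}. d i > 0" and r: "\<forall>i\<in>{1..N - 1}. r i > 0"
    and \<delta>: "\<delta> > 0"
  defines "D \<equiv> Max (d ` {1..N})" and "R \<equiv> Max (r ` {1..N - 1})"
  defines "K \<equiv> real N * real D * (real R)\<^sup>2 * ln (real N)"
  assumes m: "10240 * K \<le> real m * \<delta>\<^sup>2"
  shows "measure (gaussian_measurement m N d)
      {A \<in> space (gaussian_measurement m N d).
         \<forall>X. tt_format N d r X \<longrightarrow> \<bar>l1_deviation m N d A X\<bar> \<le> \<delta> * frob_norm N d X} > 1 - exp (- K)"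
proof -
  let ?M = "gaussian_measurement m N d"
  let ?G = "{A \<in> space ?M. \<forall>X. tt_format N d r X \<longrightarrow> \<bar>l1_deviation m N d A X\<bar> \<le> \<delta> * frob_norm N d X}"
  interpret prob_space ?M by (rule prob_space_gaussian_measurement)
  define Q where "Q = N * D * R\<^sup>2"
  have KQ: "K = real Q * ln (real N)" by (simp add: K_def Q_def)
  have dD: "d i \<le> D" if "i \<in> {1..N}" for i using that by (auto simp: D_def intro!: Max_ge)
  have D: "D \<ge> 1" using dD[of 1] d[rule_format, of 1] N by auto
  have R: "R \<ge> 1" using tt_rank_le[OF N r, of 0] by (simp add: R_def tt_rank_def)
  have lnN: "ln (real N) \<ge> ln 2" using N by simp
  have Q: "Q \<ge> 2"
  proof -
    have "2 * 1 * 1\<^sup>2 \<le> N * D * R\<^sup>2" using N D R by (intro mult_mono power_mono) auto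
    then show ?thesis by (simp add: Q_def)
  qed
  \<comment> \<open>This lower bound gives \<open>exp (- K) \<le> 1 / 4\<close>, the room needed to
    sum the failure probabilities over all levels with a strict inequality.\<close>
  have K2: "K \<ge> 2 * ln 2" unfolding KQ using Q lnN by (intro mult_mono) auto
  then have K0: "K > 0" using ln_gt_zero[of "2::real"] by linarith
  have m0: "m > 0"
  proof (rule ccontr)
    assume "\<not> m > 0"
    then show False using m K0 by simp
  qed
  have "(\<lambda>i\<in>{1..N}. 1) \<in> tensor_index N d" using d by (auto simp: tensor_index_def Suc_le_eq)
  then have ne: "{1..m} \<times> tensor_index N d \<noteq> {}" using m0 by (auto simp: Suc_le_eq)
  define q where "q = tt_rank N r"
  let ?net = "\<lambda>j S. finite S \<and> real (card S) \<le> (128 * real N / (1 / 2) ^ j) ^ Q \<and>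
      (\<forall>U. (\<forall>i\<in>{1..N}. contractive {1..d i} (q (i - 1)) (q i) (U i)) \<longrightarrow>
         (\<exists>Y\<in>S. frob_norm N d (\<lambda>s. tt_row q U N s 0 - Y s) \<le> (1 / 2) ^ j))"
  have net: "\<exists>S :: tensor set. ?net j S" for j
  proof (rule tt_net[of N d D q R "(1 / 2) ^ j"])
    show "q i \<le> R" for i using tt_rank_le[OF N r] by (simp add: q_def R_def)
  qed (use N dD D in \<open>auto simp: q_def tt_rank_0 tt_rank_N power_le_one Q_def intro!: exI\<close>)
  define S' :: "nat \<Rightarrow> tensor set" where "S' j = (SOME S. ?net j S)" for j
  have net': "?net j (S' j)" for j
    unfolding S'_def by (rule someI_ex[where P = "?net j"]) (rule net)
  have S': "finite (S' j)" "real (card (S' j)) \<le> (128 * real N / (1 / 2) ^ j) ^ Q" for j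
    using net'[of j] by blast+
  have S'_approx: "\<exists>Y\<in>S' j. frob_norm N d (\<lambda>s. tt_row q U N s 0 - Y s) \<le> (1 / 2) ^ j"
    if "\<forall>i\<in>{1..N}. contractive {1..d i} (q (i - 1)) (q i) (U i)" for j U
    using net'[of j] that by blast
  \<comment> \<open>At scale 1 the zero tensor alone is a net for chains of norm at most 1, and the
    chaining has to start where the deviation vanishes.\<close>
  define S where "S j = (if j = 0 then {\<lambda>_. 0} else S' j)" for j
  have finS: "finite (S j)" for j by (simp add: S_def S')
  have cardS: "real (card (S j)) \<le> (128 * real N / (1 / 2) ^ j) ^ Q" for j
  proof (cases "j = 0")
    case True
    have "1 \<le> (128 * real N / (1 / 2) ^ j) ^ Q"
      by (rule one_le_power) (use True N in simp)
    then show ?thesis using True by (simp only: S_def if_True) simp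
  next
    case False
    then show ?thesis using S'(2)[of j] by (simp only: S_def if_False)
  qed
  define u where "u j = \<delta> / 4 * (3 / 4) ^ j" for j :: nat
  have u: "u j > 0" for j using \<delta> by (simp add: u_def)
  define Bad where "Bad j = (\<Union>(Y, Z)\<in>{(Y, Z) \<in> S j \<times> S (Suc j). frob_norm N d (\<lambda>s. Y s - Z s) \<le> 2 * (1 / 2) ^ j}.
      {A \<in> space ?M. u j \<le> \<bar>l1_deviation m N d A Y - l1_deviation m N d A Z\<bar>})" for j
  define p where "p = exp (- 2 * K)"
  have Bad_sets: "Bad j \<in> sets ?M" for j
    unfolding Bad_def by (rule l1_deviation_level_tail[OF ne finS finS _ u]) simp
  have Bad_prob: "prob (Bad j) \<le> 2 * p ^ Suc j" for j
  proof -
    have "prob (Bad j) \<le> real (card (S j)) * real (card (S (Suc j)))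
        * (2 * exp (- (real m * (u j)\<^sup>2 / (8 * (2 * (1 / 2) ^ j)\<^sup>2))))"
      unfolding Bad_def by (rule l1_deviation_level_tail[OF ne finS finS _ u]) simp
    also have "\<dots> \<le> 2 * p ^ Suc j"
      unfolding u_def p_def KQ
      by (rule chaining_level_bound[OF N _ cardS _ cardS]) (use m KQ in auto)
    finally show ?thesis .
  qed
  have ek: "exp (- K) \<le> 1 / 4"
  proof -
    have "exp (- K) \<le> exp (- (2 * ln 2))" using K2 by simp
    also have "\<dots> = 1 / 4" by (simp add: exp_minus exp_double)
    finally show ?thesis .
  qed
  have pk: "p = (exp (- K))\<^sup>2" by (simp add: p_def exp_double[symmetric])
  have p: "0 < p" "p < 1" using K0 by (simp_all add: p_def)
  have sums: "(\<lambda>j. 2 * p ^ Suc j) sums (2 * p * (1 / (1 - p)))"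
    using sums_mult[OF geometric_sums[of p], of "2 * p"] p by (simp add: mult_ac)
  have summ: "summable (\<lambda>j. prob (Bad j))"
    by (rule summable_comparison_test'[OF sums_summable[OF sums], of 0]) (use Bad_prob in simp)
  have "prob (\<Union>j. Bad j) \<le> (\<Sum>j. prob (Bad j))"
    by (rule finite_measure_subadditive_countably) (use Bad_sets summ in auto)
  also have "\<dots> \<le> (\<Sum>j. 2 * p ^ Suc j)"
    by (rule suminf_le[OF Bad_prob summ sums_summable[OF sums]])
  also have "\<dots> = 2 * p * (1 / (1 - p))" using sums by (rule sums_unique[symmetric])
  \<comment> \<open>With \<open>z = exp (- K)\<close> and \<open>p = z\<^sup>2\<close> the claim is
    \<open>2 * z < 1 - z\<^sup>2\<close>. Half of the surplus exponent \<open>2 * K\<close> pays for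
    the factor 2 and the geometric series; the other half is the final bound.\<close>
  also have "\<dots> < exp (- K)"
  proof -
    define z where "z = exp (- K)"
    have z: "0 < z" "z \<le> 1 / 4" using ek by (simp_all add: z_def)
    have zz: "z * z \<le> 1 / 4 * (1 / 4)" using z by (intro mult_mono) auto
    have "2 * z < 1 - z * z" using z zz by linarith
    then have "z * (2 * z) < z * (1 - z * z)" using z by (intro mult_strict_left_mono)
    then have "2 * z\<^sup>2 < z * (1 - z\<^sup>2)" by (simp add: power2_eq_square mult_ac)
    then have "2 * p < z * (1 - p)" by (simp add: pk z_def)
    then show ?thesis using p by (simp add: field_simps z_def)
  qed
  finally have bad: "prob (\<Union>j. Bad j) < exp (- K)" .
  have good: "space ?M - (\<Union>j. Bad j) \<subseteq> ?G"
  proof (intro subsetI CollectI conjI allI impI)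
    fix A assume A: "A \<in> space ?M - (\<Union>j. Bad j)"
    then show "A \<in> space ?M" by blast
    fix X assume tt: "tt_format N d r X"
    obtain U \<rho> where
      U: "\<And>i. i \<in> {1..N} \<Longrightarrow> contractive {1..d i} (q (i - 1)) (q i) (U i)"
      and X: "\<And>s. s \<in> tensor_index N d \<Longrightarrow> X s = \<rho> * tt_row q U N s 0"
      and \<rho>: "\<bar>\<rho>\<bar> = frob_norm N d X" and U1: "frob_norm N d (\<lambda>s. tt_row q U N s 0) \<le> 1"
    proof (rule tt_format_contractive[OF tt, folded q_def], goal_cases)
      case (1 U \<rho>)
      show ?case by (rule 1(1)[of U \<rho>]) (fact 1(2-5))+
    qed
    have "\<bar>l1_deviation m N d A (\<lambda>s. tt_row q U N s 0)\<bar> \<le> \<delta>"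
    proof (rule l1_deviation_chaining[where S = S])
      show "S 0 = {\<lambda>_. 0}" by (simp add: S_def)
      show "\<exists>Y\<in>S j. frob_norm N d (\<lambda>s. tt_row q U N s 0 - Y s) \<le> (1 / 2) ^ j" for j
        using S'_approx[of U j] U U1 by (cases "j = 0") (auto simp: S_def)
      show "\<bar>l1_deviation m N d A Y - l1_deviation m N d A Z\<bar> \<le> \<delta> / 4 * (3 / 4) ^ j"
        if "Y \<in> S j" "Z \<in> S (Suc j)" "frob_norm N d (\<lambda>s. Y s - Z s) \<le> 2 * (1 / 2) ^ j" for j Y Z
      proof (rule ccontr)
        assume "\<not> \<bar>l1_deviation m N d A Y - l1_deviation m N d A Z\<bar> \<le> \<delta> / 4 * (3 / 4) ^ j"
        then have "A \<in> Bad j" using that A by (force simp: Bad_def u_def)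
        then show False using A by blast
      qed
    qed (use \<delta> in simp)
    then show "\<bar>l1_deviation m N d A X\<bar> \<le> \<delta> * frob_norm N d X"
      using l1_deviation_scale[of N d X \<rho> "\<lambda>s. tt_row q U N s 0" m A] X \<rho>
        mult_right_mono[of "\<bar>l1_deviation m N d A (\<lambda>s. tt_row q U N s 0)\<bar>" \<delta> "\<bar>\<rho>\<bar>"]
      by (simp add: abs_mult mult.commute)
  qed
  have "1 - exp (- K) < 1 - prob (\<Union>j. Bad j)" using bad by simp
  also have "\<dots> = prob (space ?M - (\<Union>j. Bad j))"
    using Bad_sets by (subst prob_compl) auto
  also have "\<dots> \<le> prob ?G"
    by (rule finite_measure_mono[OF good sets_l1_deviation_all])
  finally show ?thesis .
qed

theorem theorem1:
  shows "\<exists>C c :: real. C > 0 \<and> c > 0 \<and>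
    (\<forall>(N :: nat) (d :: nat \<Rightarrow> nat) (r :: nat \<Rightarrow> nat) (dmax :: nat) (rmax :: nat) (m :: nat) (\<delta> :: real).
       N \<ge> 2 \<longrightarrow>
       (\<forall>i\<in>{1..N}. d i > 0) \<longrightarrow>
       (\<forall>i\<in>{1..N - 1}. r i > 0) \<longrightarrow>
       dmax = Max (d ` {1..N}) \<longrightarrow>
       rmax = Max (r ` {1..N - 1}) \<longrightarrow>
       \<delta> \<in> {0<..<sqrt (2 / pi)} \<longrightarrow>
       real m \<ge> C * (real N * real dmax * (real rmax)\<^sup>2 * ln (real N)) / \<delta>\<^sup>2 \<longrightarrow>
       measure (gaussian_measurement m N d)
         {A \<in> space (gaussian_measurement m N d).
            \<forall>X. tt_format N d r X \<longrightarrow>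
              (sqrt (2 / pi) - \<delta>) * frob_norm N d X \<le> 1 / real m * l1_norm m (measure_op N d A X) \<and>
              1 / real m * l1_norm m (measure_op N d A X) \<le> (sqrt (2 / pi) + \<delta>) * frob_norm N d X}
       > 1 - exp (- c * (real N * real dmax * (real rmax)\<^sup>2 * ln (real N))))"
proof -
  have eq: "(sqrt (2 / pi) - \<delta>) * frob_norm N d X \<le> 1 / real m * l1_norm m (measure_op N d A X) \<and>
      1 / real m * l1_norm m (measure_op N d A X) \<le> (sqrt (2 / pi) + \<delta>) * frob_norm N d X
    \<longleftrightarrow> \<bar>l1_deviation m N d A X\<bar> \<le> \<delta> * frob_norm N d X" for m N d A X \<delta>
    unfolding l1_deviation_def abs_le_iff by (auto simp: left_diff_distrib distrib_right)
  show ?thesis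
    unfolding eq
  \<comment> \<open>\<open>C = 10240\<close> is what \<open>chaining_level_bound\<close> needs at
    every level, and \<open>c = 1\<close> is the rate left after summing the levels.\<close>
  proof (rule exI[of _ 10240], rule exI[of _ 1], intro conjI allI impI)
    fix N m dmax rmax :: nat and d r :: "nat \<Rightarrow> nat" and \<delta> :: real
    assume N: "N \<ge> 2" and d: "\<forall>i\<in>{1..N}. d i > 0" and r: "\<forall>i\<in>{1..N - 1}. r i > 0"
      and D: "dmax = Max (d ` {1..N})" and R: "rmax = Max (r ` {1..N - 1})"
      and \<delta>: "\<delta> \<in> {0<..<sqrt (2 / pi)}"
      and m: "10240 * (real N * real dmax * (real rmax)\<^sup>2 * ln (real N)) / \<delta>\<^sup>2 \<le> real m"
    have \<delta>0: "\<delta> > 0" using \<delta> by simp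
    have m': "10240 * (real N * real dmax * (real rmax)\<^sup>2 * ln (real N)) \<le> real m * \<delta>\<^sup>2"
      using m \<delta>0 by (simp add: divide_le_eq)
    show "1 - exp (- 1 * (real N * real dmax * (real rmax)\<^sup>2 * ln (real N)))
      < measure (gaussian_measurement m N d)
          {A \<in> space (gaussian_measurement m N d).
             \<forall>X. tt_format N d r X \<longrightarrow> \<bar>l1_deviation m N d A X\<bar> \<le> \<delta> * frob_norm N d X}"
      using tt_l1_deviation_prob[OF N d r \<delta>0, of m] m' unfolding D R by simp
  qed simp_all
qed

end
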